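(* Let $T$ be a circle map $T(x)=x(1+V(x)) \bmod 1$ as described in the context. Let $\omega$ and $\Omega$ be moduli of continuity such that $\Omega$ is $T$-compatible with respect to $\omega$, and assume that $\Omega$ is concave and vanishes orderly. Let $f\in\mathscr C_\omega(\mathbb T)$ and let $\chi$ be the maximal eigenvalue of $\mathscr L_f$. Consider $\mathscr L_f$ acting on the space of complex-valued continuous functions on $\mathbb T$ that admit $\Omega$ as a modulus of continuity, with norm $\|\phi\|_\Omega=\|\phi\|_\infty+|\phi|_\Omega$. Then there is $r<\chi$ such that every element of the spectrum of $\mathscr L_f$ on this space other than $\chi$ lies in the disc $\{z\in\mathbb C: |z|\le r\}$.
   Context: Phase space and dynamics: $\mathbb T=[0,1)$ is the circle with metric $d(x,y)=\min\{|x-y|,|x-y\pm1|\}$. $T:\mathbb T\to\mathbb T$ is the continuous map $T(x)=x(1+V(x)) \bmod 1$, where $V:[0,\infty)\to[0,\infty)$ is continuous and increasing, $V(1)$ is a positive integer, and $V$ is regularly varying at $0$: there is $\sigma\ge0$ with $\lim_{x\to0}V(tx)/V(x)=t^\sigma$ for all $t>0$. Moduli of continuity: a modulus of continuity is a continuous non-decreasing function $\omega:[0,\infty)\to[0,\infty)$ with $\omega(0)=0$ (and $\omega(t)>0$ for $t>0$, so that the quotients below make sense). For a function $f$ on $\mathbb T$, $|f|_\omega:=\sup_{x\ne y}|f(x)-f(y)|/\omega(d(x,y))$; $f$ admits $\omega$ as a modulus of continuity if $|f|_\omega<\infty$. $\mathscr C_\omega(\mathbb T)$ is the space of real-valued continuous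 functions $f$ on $\mathbb T$ with $|f|_\omega<\infty$. $T$-compatibility: a pre-orbit of $x_0$ is a sequence $\{x_k\}_{k\ge0}$ with $T(x_{k+1})=x_k$ for all $k$. $\Omega$ is $T$-compatible with respect to $\omega$ if there are constants $\varrho_1,C_1>0$ such that, for any $x_0,y_0$ with $d(x_0,y_0)<\varrho_1$, there is a bijection between the pre-orbits $\{x_k\}$ of $x_0$ and the pre-orbits $\{y_k\}$ of $y_0$ such that corresponding pre-orbits satisfy, for all $k$, $d(x_k,y_k)\le d(x_0,y_0)<\varrho_1$ and $C_1\sum_{j=1}^k\omega(d(x_j,y_j))\le\Omega(d(x_0,y_0))-\Omega(d(x_k,y_k))$. $\Omega$ vanishes orderly if $\lim_{x\to0^+}\sup_{0<\mathsf d<1/2}\Omega(\mathsf d x)/\Omega(\mathsf d)=0$. Transfer operator: $\mathscr L_f\phi(x)=\sum_{y\in T^{-1}(x)}e^{f(y)}\phi(y)$. Known fact (Ruelle-Perron-Frobenius theorem from earlier work): if $\Omega$ is $T$-compatible with respect to $\omega$ and $f\in\mathscr C_\omega(\mathbb T)$, there are $\chi>0$ (the maximal eigenvalue), a strictly positive $h\in\mathscr C_\Omega(\mathbb T)$ and a Borel probability measure $\nu$ with $\mathscr L_fh=\chi h$, $\mathscr L_f^*\nu=\chi\nu$, $\int h\,d\nu=1$, and $\chi^{-n}\mathscr L_f^n\psi\to h\int\psi\,d\nu$ uniformly for every continuous $\psi$. (For complex-valued functions, real and imaginary parts are treated separately.) *)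

theory Defs
  imports "HOL-Probability.Probability"
begin

section \<open>The circle\<close>

typedef circle = "{0..<1::real}"
  by (rule exI[of _ 0]) simp

instantiation circle :: metric_space
begin

definition dist_circle :: "circle \<Rightarrow> circle \<Rightarrow> real" where
  "dist_circle x y =
     (let s = Rep_circle x - Rep_circle y in min \<bar>s\<bar> (min \<bar>s + 1\<bar> \<bar>s - 1\<bar>))"

definition uniformity_circle :: "(circle \<times> circle) filter" where
  "uniformity_circle = (INF e\<in>{0<..}. principal {(x, y). dist x y < e})"

definition open_circle :: "circle set \<Rightarrow> bool" where
  "open_circle U = (\<forall>x\<in>U. \<forall>\<^sub>F (x', y) in uniformity. x' = x \<longrightarrow> y \<in> U)"

instance
proof
  fix x y z :: circle
  have bds: "0 \<le> Rep_circle u" "Rep_circle u < 1" for u :: circle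
    using Rep_circle[of u] by auto
  have attained: "\<exists>k::int. dist u v = \<bar>Rep_circle u - Rep_circle v + of_int k\<bar>" for u v :: circle
  proof -
    let ?s = "Rep_circle u - Rep_circle v"
    have "dist u v = \<bar>?s + of_int 0\<bar> \<or> dist u v = \<bar>?s + of_int 1\<bar> \<or> dist u v = \<bar>?s + of_int (-1)\<bar>"
      by (simp add: dist_circle_def Let_def min_def)
    then show ?thesis by blast
  qed
  have minimal: "dist u v \<le> \<bar>Rep_circle u - Rep_circle v + of_int k\<bar>" for u v :: circle and k :: int
  proof -
    let ?s = "Rep_circle u - Rep_circle v"
    have s: "\<bar>?s\<bar> < 1" using bds[of u] bds[of v] by (simp add: abs_less_iff)
    have le: "dist u v \<le> \<bar>?s\<bar>" "dist u v \<le> \<bar>?s + 1\<bar>" "dist u v \<le> \<bar>?s - 1\<bar>"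
      by (simp_all add: dist_circle_def Let_def min_le_iff_disj)
    consider "k = 0" | "k = 1" | "k = -1" | "\<bar>k\<bar> \<ge> 2" by linarith
    then show ?thesis
    proof cases
      case 4
      then have "\<bar>real_of_int k\<bar> \<ge> 2" by linarith
      with s le(1) show ?thesis by linarith
    qed (use le in auto)
  qed
  show "dist x y = 0 \<longleftrightarrow> x = y"
  proof
    assume "dist x y = 0"
    then obtain k where "Rep_circle x - Rep_circle y + of_int k = 0"
      using attained[of x y] by auto
    moreover from this have "k = 0"
      using bds[of x] bds[of y] by linarith
    ultimately show "x = y" by (simp add: Rep_circle_inject)
  qed (simp add: dist_circle_def)
  show "dist x y \<le> dist x z + dist y z"
  proof -
    obtain k l :: int where
      "dist x z = \<bar>Rep_circle x - Rep_circle z + of_int k\<bar>"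
      "dist y z = \<bar>Rep_circle y - Rep_circle z + of_int l\<bar>"
      using attained by blast
    then show ?thesis using minimal[of x y "k - l"] by simp
  qed
qed (simp_all add: uniformity_circle_def open_circle_def)

end

definition to_circle :: "real \<Rightarrow> circle" where
  "to_circle s = Abs_circle (frac s)"


section \<open>The map\<close>

definition regularly_varying_at_0 :: "(real \<Rightarrow> real) \<Rightarrow> bool" where
  "regularly_varying_at_0 V \<longleftrightarrow>
     (\<exists>\<sigma>\<ge>0. \<forall>t>0. ((\<lambda>x. V (t * x) / V x) \<longlongrightarrow> t powr \<sigma>) (at_right 0))"

text \<open>Functions on \<open>[0, \<infinity>)\<close> are represented by functions on the reals whose
  values at negative arguments are irrelevant.\<close>

definition admissible :: "(real \<Rightarrow> real) \<Rightarrow> bool" where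
  "admissible V \<longleftrightarrow>
     (\<forall>x\<ge>0. V x \<ge> 0) \<and> continuous_on {0..} V \<and> mono_on {0..} V \<and>
     (\<exists>m::nat. m > 0 \<and> V 1 = real m) \<and> regularly_varying_at_0 V"

definition circle_map :: "(real \<Rightarrow> real) \<Rightarrow> circle \<Rightarrow> circle" where
  "circle_map V x = to_circle (Rep_circle x * (1 + V (Rep_circle x)))"


section \<open>Moduli of continuity\<close>

definition modulus_of_continuity :: "(real \<Rightarrow> real) \<Rightarrow> bool" where
  "modulus_of_continuity \<omega> \<longleftrightarrow>
     continuous_on {0..} \<omega> \<and> mono_on {0..} \<omega> \<and> \<omega> 0 = 0 \<and> (\<forall>t>0. \<omega> t > 0)"

text \<open>For \<open>0 < x \<le> 1\<close> the quotients below lie in \<open>[0, 1]\<close> when \<open>\<Omega>\<close> is a modulus of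
  continuity, so the real supremum is the true one near \<open>0\<close>.\<close>

definition vanishes_orderly :: "(real \<Rightarrow> real) \<Rightarrow> bool" where
  "vanishes_orderly \<Omega> \<longleftrightarrow>
     ((\<lambda>x. SUP d\<in>{0<..<1/2}. \<Omega> (d * x) / \<Omega> d) \<longlongrightarrow> 0) (at_right 0)"

definition modulus_quotients ::
    "(real \<Rightarrow> real) \<Rightarrow> (circle \<Rightarrow> 'b::real_normed_vector) \<Rightarrow> real set" where
  "modulus_quotients \<omega> \<phi> = {norm (\<phi> x - \<phi> y) / \<omega> (dist x y) | x y. x \<noteq> y}"

definition modulus_space :: "(real \<Rightarrow> real) \<Rightarrow> (circle \<Rightarrow> 'b::real_normed_vector) set" where
  "modulus_space \<omega> = {\<phi>. continuous_on UNIV \<phi> \<and> bdd_above (modulus_quotients \<omega> \<phi>)}"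

text \<open>The real suprema in the next two definitions are meaningful on
  \<open>modulus_space \<omega>\<close>, where both sets are bounded above.\<close>

definition modulus_seminorm :: "(real \<Rightarrow> real) \<Rightarrow> (circle \<Rightarrow> 'b::real_normed_vector) \<Rightarrow> real" where
  "modulus_seminorm \<omega> \<phi> = Sup (modulus_quotients \<omega> \<phi>)"

definition modulus_norm :: "(real \<Rightarrow> real) \<Rightarrow> (circle \<Rightarrow> 'b::real_normed_vector) \<Rightarrow> real" where
  "modulus_norm \<omega> \<phi> = (SUP x. norm (\<phi> x)) + modulus_seminorm \<omega> \<phi>"


section \<open>Compatibility\<close>

definition pre_orbits :: "(circle \<Rightarrow> circle) \<Rightarrow> circle \<Rightarrow> (nat \<Rightarrow> circle) set" where
  "pre_orbits T x0 = {x. x 0 = x0 \<and> (\<forall>k. T (x (Suc k)) = x k)}"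

definition compatible ::
    "(circle \<Rightarrow> circle) \<Rightarrow> (real \<Rightarrow> real) \<Rightarrow> (real \<Rightarrow> real) \<Rightarrow> bool" where
  "compatible T \<Omega> \<omega> \<longleftrightarrow>
     (\<exists>\<rho>>0. \<exists>C>0. \<forall>x0 y0. dist x0 y0 < \<rho> \<longrightarrow>
        (\<exists>B. bij_betw B (pre_orbits T x0) (pre_orbits T y0) \<and>
           (\<forall>x\<in>pre_orbits T x0. \<forall>k.
              dist (x k) (B x k) \<le> dist x0 y0 \<and>
              C * (\<Sum>j=1..k. \<omega> (dist (x j) (B x j)))
                \<le> \<Omega> (dist x0 y0) - \<Omega> (dist (x k) (B x k)))))"


section \<open>The transfer operator and its maximal eigenvalue\<close>

definition transfer_op ::
    "(circle \<Rightarrow> circle) \<Rightarrow> (circle \<Rightarrow> real) \<Rightarrow> (circle \<Rightarrow> 'b::real_vector) \<Rightarrow> circle \<Rightarrow> 'b" where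
  "transfer_op T f \<phi> x = (\<Sum>y\<in>T -` {x}. exp (f y) *\<^sub>R \<phi> y)"

lemma finite_circle_map_vimage:
  assumes "admissible V"
  shows "finite (circle_map V -` {x})"
proof -
  define g where "g s = s * (1 + V s)" for s :: real
  have nonneg: "V s \<ge> 0" if "s \<ge> 0" for s
    using assms that by (simp add: admissible_def)
  have mono: "V s \<le> V t" if "0 \<le> s" "s \<le> t" for s t
    using assms that by (auto simp: admissible_def monotone_on_def)
  have less: "g s < g t" if "0 \<le> s" "s < t" for s t
  proof -
    have "s * (1 + V s) \<le> s * (1 + V t)"
      using mono[of s t] that by (intro mult_left_mono) auto
    also have "\<dots> < t * (1 + V t)"
      using nonneg[of t] that by (intro mult_strict_right_mono) auto
    finally show ?thesis by (simp add: g_def)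
  qed
  have inj: "inj_on g {0..}"
    by (rule linorder_inj_onI) (auto dest: less)
  have "Rep_circle ` (circle_map V -` {x}) \<subseteq>
      (\<Union>k\<in>{0..\<lfloor>g 1\<rfloor>}. {s\<in>{0..}. g s = of_int k + Rep_circle x})"
  proof (intro subsetI)
    fix s assume "s \<in> Rep_circle ` (circle_map V -` {x})"
    then obtain y where y: "circle_map V y = x" "s = Rep_circle y" by auto
    have s: "0 \<le> s" "s < 1" using Rep_circle[of y] y by auto
    have "frac (g s) \<in> {0..<1}" by (simp add: frac_lt_1)
    then have "frac (g s) = Rep_circle x"
      using y by (auto simp: circle_map_def to_circle_def g_def Abs_circle_inverse)
    then have "g s = of_int \<lfloor>g s\<rfloor> + Rep_circle x"
      by (simp add: frac_def)
    moreover have "0 \<le> g s" using s nonneg[of s] by (simp add: g_def)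
    moreover have "\<lfloor>g s\<rfloor> \<le> \<lfloor>g 1\<rfloor>" using less[of s 1] s by (intro floor_mono) auto
    ultimately show "s \<in> (\<Union>k\<in>{0..\<lfloor>g 1\<rfloor>}. {s\<in>{0..}. g s = of_int k + Rep_circle x})"
      using s by (intro UN_I[of "\<lfloor>g s\<rfloor>"]) auto
  qed
  moreover have "finite {s\<in>{0..}. g s = c}" for c
  proof -
    have "finite (g -` {c} \<inter> {0..})" by (intro finite_vimage_IntI inj) simp
    moreover have "{s\<in>{0..}. g s = c} = g -` {c} \<inter> {0..}" by auto
    ultimately show ?thesis by simp
  qed
  ultimately have "finite (Rep_circle ` (circle_map V -` {x}))"
    by (meson finite_UN_I finite_atLeastAtMost_int finite_subset)
  then show ?thesis
    by (rule finite_imageD) (simp add: inj_on_def Rep_circle_inject)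
qed

text \<open>The eigenvalue, eigenfunction and eigenmeasure supplied by the
  Ruelle-Perron-Frobenius theorem. The eigenvalue is determined by \<open>T\<close> and \<open>f\<close> alone,
  see \<open>maximal_eigenvalue_unique\<close>.\<close>

definition RPF_triple ::
    "(circle \<Rightarrow> circle) \<Rightarrow> (real \<Rightarrow> real) \<Rightarrow> (circle \<Rightarrow> real) \<Rightarrow>
     real \<Rightarrow> (circle \<Rightarrow> real) \<Rightarrow> circle measure \<Rightarrow> bool" where
  "RPF_triple T \<Omega> f chi h \<nu> \<longleftrightarrow>
     chi > 0 \<and>
     h \<in> modulus_space \<Omega> \<and> (\<forall>x. h x > 0) \<and>
     prob_space \<nu> \<and> sets \<nu> = sets borel \<and>
     (\<forall>x. transfer_op T f h x = chi * h x) \<and>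
     (\<forall>\<psi>::circle \<Rightarrow> real. continuous_on UNIV \<psi> \<longrightarrow>
        (\<integral>x. transfer_op T f \<psi> x \<partial>\<nu>) = chi * (\<integral>x. \<psi> x \<partial>\<nu>)) \<and>
     (\<integral>x. h x \<partial>\<nu>) = 1 \<and>
     (\<forall>\<psi>::circle \<Rightarrow> real. continuous_on UNIV \<psi> \<longrightarrow>
        uniform_limit UNIV
          (\<lambda>n x. ((transfer_op T f ^^ n) \<psi>) x / chi ^ n)
          (\<lambda>x. h x * (\<integral>y. \<psi> y \<partial>\<nu>)) sequentially)"

definition maximal_eigenvalue ::
    "(circle \<Rightarrow> circle) \<Rightarrow> (real \<Rightarrow> real) \<Rightarrow> (circle \<Rightarrow> real) \<Rightarrow> real \<Rightarrow> bool" where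
  "maximal_eigenvalue T \<Omega> f chi \<longleftrightarrow> (\<exists>h \<nu>. RPF_triple T \<Omega> f chi h \<nu>)"

lemma maximal_eigenvalue_unique:
  assumes "maximal_eigenvalue T \<Omega> f chi" "maximal_eigenvalue T \<Omega>' f chi'"
  shows "chi = chi'"
proof -
  have pos_limit: "\<exists>l>0. (\<lambda>n. ((transfer_op T f ^^ n) (\<lambda>_. 1::real)) x0 / c ^ n) \<longlonglongrightarrow> l"
    if rpf: "RPF_triple T W f c h \<nu>" for W c h \<nu> x0
  proof -
    interpret prob_space \<nu> using rpf by (simp add: RPF_triple_def)
    have "uniform_limit UNIV
        (\<lambda>n x. ((transfer_op T f ^^ n) (\<lambda>_. 1::real)) x / c ^ n)
        (\<lambda>x. h x * (\<integral>y. 1 \<partial>\<nu>)) sequentially"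
      using rpf by (simp only: RPF_triple_def continuous_on_const)
    then have "(\<lambda>n. ((transfer_op T f ^^ n) (\<lambda>_. 1::real)) x0 / c ^ n) \<longlonglongrightarrow> h x0"
      by (auto dest: tendsto_uniform_limitI[where x = x0] simp: prob_space)
    moreover have "h x0 > 0" using rpf by (simp add: RPF_triple_def)
    ultimately show ?thesis by blast
  qed
  have not_less: "\<not> a < b"
    if rpf: "RPF_triple T W f a h \<nu>" "RPF_triple T W' f b h' \<nu>'" for W W' a b h h' \<nu> \<nu>'
  proof
    assume "a < b"
    define u where "u n = ((transfer_op T f ^^ n) (\<lambda>_. 1::real)) (to_circle 0)" for n
    have ab: "a > 0" "b > 0" using rpf by (auto simp: RPF_triple_def)
    obtain l where l: "(\<lambda>n. u n / a ^ n) \<longlonglongrightarrow> l"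
      using pos_limit[OF rpf(1), of "to_circle 0"] by (auto simp: u_def)
    obtain l' where l': "l' > 0" "(\<lambda>n. u n / b ^ n) \<longlonglongrightarrow> l'"
      using pos_limit[OF rpf(2), of "to_circle 0"] by (auto simp: u_def)
    have "(\<lambda>n. (a / b) ^ n) \<longlonglongrightarrow> 0"
      using ab \<open>a < b\<close> by (intro LIMSEQ_power_zero) auto
    then have "(\<lambda>n. u n / a ^ n * (a / b) ^ n) \<longlonglongrightarrow> l * 0"
      by (intro tendsto_mult l)
    moreover have "(\<lambda>n. u n / a ^ n * (a / b) ^ n) = (\<lambda>n. u n / b ^ n)"
      using ab by (auto simp: field_simps)
    ultimately have "l' = 0" using l'(2) LIMSEQ_unique by fastforce
    with l'(1) show False by simp
  qed
  show ?thesis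
    using assms not_less unfolding maximal_eigenvalue_def by (meson linorder_neqE)
qed


section \<open>Spectrum\<close>

text \<open>The spectrum of an operator \<open>L\<close> on a complex normed space of functions with
  carrier \<open>X\<close> and norm \<open>N\<close>: the complement of those \<open>z\<close> for which \<open>z - L\<close> is a
  bijection of \<open>X\<close> with bounded inverse.\<close>

definition spectrum_on ::
    "('a \<Rightarrow> complex) set \<Rightarrow> (('a \<Rightarrow> complex) \<Rightarrow> real) \<Rightarrow>
     (('a \<Rightarrow> complex) \<Rightarrow> 'a \<Rightarrow> complex) \<Rightarrow> complex set" where
  "spectrum_on X N L =
     {z. \<not> (bij_betw (\<lambda>\<phi> x. z * \<phi> x - L \<phi> x) X X \<and>
            (\<exists>K. \<forall>\<phi>\<in>X. N \<phi> \<le> K * N (\<lambda>x. z * \<phi> x - L \<phi> x)))}"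

end

theory Submission
  imports Defs
begin

text \<open>Conjugating the transfer operator by its eigenfunction \<open>h\<close> and dividing by \<open>chi\<close> gives an
  averaging operator \<open>P\<close> with \<open>P 1 = 1\<close>. Over two nearby points the preimages are paired by
  compatibility, all at distance at most the original one \<open>d\<close>, and at least one pair stays away
  from the neutral fixed point and is contracted by a uniform factor. After sufficiently many
  steps a definite fraction of the weight sits on pairs at distance \<open>lam ^ N * d\<close>, where
  \<open>\<Omega>\<close> has at most half its value at \<open>d\<close> because it vanishes orderly. This yields a Lasota-Yorke
  inequality \<open>|P ^ N \<phi>| \<le> \<theta> |\<phi>| + B \<parallel>\<phi>\<parallel>\<close> with \<open>\<theta> < 1\<close> for the \<open>\<Omega>\<close>-seminorm. Together with
  the uniform convergence of \<open>P ^ n \<phi>\<close> to constants, it makes \<open>P ^ n\<close> decay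
  exponentially on the functions whose limit is \<open>0\<close>, and the resolvent is a Neumann series there.\<close>

section \<open>The circle and its map\<close>

text \<open>The obstacle is the fixed point \<open>0\<close>, where the expansion factor
  \<open>1 + V s\<close> may tend to \<open>1\<close>: the inverse branches of an iterate need not
  share a contraction factor below \<open>1\<close>. The seminorm therefore drops through the share
  of the weight on the better branches, and positivity of \<open>h\<close> on the compact circle
  bounds that share from below. The gain must also be the same at every scale: for a general
  modulus, \<open>\<Omega> (lam ^ N * d) / \<Omega> d\<close> may approach \<open>1\<close> as
  \<open>d\<close> tends to \<open>0\<close>, and the supremum over \<open>d\<close> in
  \<open>vanishes_orderly\<close> is what allows one \<open>N\<close> for all distances.
  Compatibility has a second use: it bounds \<open>\<omega>\<close> along paired preimages by
  \<open>\<Omega>\<close> at the base points, so the variation of \<open>f\<close>, measured by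
  \<open>\<omega>\<close>, becomes a distortion of the weights measured by \<open>\<Omega>\<close>.
  This distortion is multiplied by the sup norm, so the sup norm has to become small first,
  uniformly on the unit ball, before the seminorm can be made to decay. The value \<open>chi\<close>
  stands apart because constants, which correspond to multiples of \<open>h\<close>, are split off
  before the resolvent series is summed.\<close>

lemma Rep_circle_bounds: "0 \<le> Rep_circle x" "Rep_circle x < 1"
  using Rep_circle[of x] by auto

lemma Rep_to_circle: "Rep_circle (to_circle s) = frac s"
  by (simp add: to_circle_def Abs_circle_inverse frac_lt_1)

lemma to_circle_Rep: "to_circle (Rep_circle x) = x"
  using Rep_circle_bounds[of x] by (simp add: to_circle_def frac_eq Rep_circle_inverse)

lemma dist_circle_cases:
  obtains "dist x y = \<bar>Rep_circle x - Rep_circle y\<bar>"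
  | "dist x y = \<bar>Rep_circle x - Rep_circle y + 1\<bar>"
  | "dist x y = \<bar>Rep_circle x - Rep_circle y - 1\<bar>"
  unfolding dist_circle_def Let_def min_def by (metis (full_types))

lemma dist_circle_le: "dist x y \<le> \<bar>Rep_circle x - Rep_circle y + of_int k\<bar>"
proof -
  have le: "dist x y \<le> \<bar>Rep_circle x - Rep_circle y\<bar>"
    "dist x y \<le> \<bar>Rep_circle x - Rep_circle y + 1\<bar>"
    "dist x y \<le> \<bar>Rep_circle x - Rep_circle y - 1\<bar>"
    by (simp_all add: dist_circle_def Let_def min_le_iff_disj)
  consider "k = 0" | "k = 1" | "k = -1" | "\<bar>k\<bar> \<ge> 2" by linarith
  then show ?thesis
  proof cases
    case 4
    then have "\<bar>real_of_int k\<bar> \<ge> 2" by linarith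
    with le(1) show ?thesis using Rep_circle_bounds[of x] Rep_circle_bounds[of y] by linarith
  qed (use le in auto)
qed

lemma dist_to_circle_le: "dist (to_circle s) (to_circle t) \<le> \<bar>s - t\<bar>"
  using dist_circle_le[of "to_circle s" "to_circle t" "\<lfloor>s\<rfloor> - \<lfloor>t\<rfloor>"]
  by (simp add: Rep_to_circle frac_def algebra_simps)

text \<open>A nonzero integer shift takes a number of modulus at most 1/2 to one of modulus at least
  1/2, so no other choice of representatives is closer.\<close>

lemma dist_to_circle:
  assumes "\<bar>s - t\<bar> \<le> 1/2"
  shows "dist (to_circle s) (to_circle t) = \<bar>s - t\<bar>"
proof (rule antisym[OF dist_to_circle_le])
  have *: "\<bar>s - t\<bar> \<le> \<bar>s - t + of_int k\<bar>" for k :: int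
  proof (cases "k = 0")
    case False
    then have "\<bar>real_of_int k\<bar> \<ge> 1" by linarith
    then show ?thesis using assms by linarith
  qed simp
  have **: "\<bar>s - t\<bar> \<le> \<bar>Rep_circle (to_circle s) - Rep_circle (to_circle t) + of_int k\<bar>" for k
    using *[of "k - \<lfloor>s\<rfloor> + \<lfloor>t\<rfloor>"] by (simp add: Rep_to_circle frac_def algebra_simps)
  show "\<bar>s - t\<bar> \<le> dist (to_circle s) (to_circle t)"
    using **[of 0] **[of 1] **[of "-1"]
    by (cases rule: dist_circle_cases[of "to_circle s" "to_circle t"]) simp_all
qed

lemma to_circle_eq_iff: "to_circle s = to_circle t \<longleftrightarrow> s - t \<in> \<int>"
proof
  assume "to_circle s = to_circle t"
  then have "frac s = frac t" by (metis Rep_to_circle)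
  then have "s - t = of_int (\<lfloor>s\<rfloor> - \<lfloor>t\<rfloor>)" by (simp add: frac_def)
  then show "s - t \<in> \<int>" by (metis Ints_of_int)
next
  assume "s - t \<in> \<int>"
  then obtain k where "s = t + of_int k" by (metis Ints_cases add.commute diff_add_cancel)
  then show "to_circle s = to_circle t" by (simp add: to_circle_def frac_def)
qed

lemma dist_circle_le_half: "dist (x :: circle) y \<le> 1/2"
proof -
  have "dist x y \<le> \<bar>Rep_circle x - Rep_circle y\<bar>"
    "dist x y \<le> \<bar>Rep_circle x - Rep_circle y + 1\<bar>"
    "dist x y \<le> \<bar>Rep_circle x - Rep_circle y - 1\<bar>"
    by (simp_all add: dist_circle_def Let_def min_le_iff_disj)
  then show ?thesis using Rep_circle_bounds[of x] Rep_circle_bounds[of y] by linarith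
qed

lemma compact_circle: "compact (UNIV :: circle set)"
proof -
  have "continuous_on {0..1} to_circle"
    unfolding continuous_on_iff
    by (metis dist_real_def dist_to_circle_le le_less_trans)
  moreover have "x \<in> to_circle ` {0..1}" for x
    using Rep_circle_bounds[of x] by (intro image_eqI[of _ _ "Rep_circle x"]) (auto simp: to_circle_Rep)
  then have "to_circle ` {0..1} = UNIV" by blast
  ultimately show ?thesis by (metis compact_Icc compact_continuous_image)
qed

section \<open>The lift of the map: expansion, preimages, pairing\<close>

context
  fixes V :: "real \<Rightarrow> real"
  assumes V: "admissible V"
begin

definition lift_map :: "real \<Rightarrow> real" where
  "lift_map s = s * (1 + V s)"

lemma circle_map_eq: "circle_map V x = to_circle (lift_map (Rep_circle x))"
  by (simp add: circle_map_def lift_map_def)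

lemma V_nonneg: "s \<ge> 0 \<Longrightarrow> V s \<ge> 0"
  using V by (simp add: admissible_def)

lemma V_mono: "0 \<le> s \<Longrightarrow> s \<le> t \<Longrightarrow> V s \<le> V t"
  using V by (auto simp: admissible_def monotone_on_def)

text \<open>Regular variation forbids \<open>V\<close> to vanish near \<open>0\<close>, and
  monotonicity carries positivity further. This is the source of all expansion.\<close>

lemma V_pos:
  assumes "s > 0"
  shows "V s > 0"
proof (rule ccontr)
  assume "\<not> V s > 0"
  then have zero: "V t = 0" if "0 < t" "t < s" for t
    using V_nonneg[of t] V_mono[of t s] that by linarith
  obtain \<sigma> where "\<forall>t>0. ((\<lambda>x. V (t * x) / V x) \<longlongrightarrow> t powr \<sigma>) (at_right 0)"
    using V by (auto simp: admissible_def regularly_varying_at_0_def)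
  then have lim: "((\<lambda>x. V (1 * x) / V x) \<longlongrightarrow> 1 powr \<sigma>) (at_right 0)"
    by (metis zero_less_one)
  \<comment> \<open>Division by zero yields \<open>0\<close>, so the quotient with
    \<open>t = 1\<close> would be \<open>0\<close> near the origin, against the limit
    \<open>1 powr \<sigma> = 1\<close>.\<close>
  have "\<forall>\<^sub>F x in at_right 0. V (1 * x) / V x = 0"
    using zero assms unfolding eventually_at_right_field by auto
  then have "((\<lambda>x. V (1 * x) / V x) \<longlongrightarrow> 0) (at_right 0)"
    by (rule tendsto_eventually)
  then have "1 powr \<sigma> = 0"
    using tendsto_unique[OF trivial_limit_at_right_real lim] by blast
  then show False by simp
qed

text \<open>The right-hand side is \<open>(s - t) * (1 + V s) + t * (V s - V t)\<close>. The factor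
  involves the larger point, so expansion is strict as soon as one of the two points is away from
  \<open>0\<close>.\<close>

lemma lift_map_expand:
  assumes "0 \<le> t" "t \<le> s"
  shows "(s - t) * (1 + V s) \<le> lift_map s - lift_map t"
proof -
  have "0 \<le> t * (V s - V t)" using V_mono[of t s] assms by simp
  then show ?thesis by (simp add: lift_map_def algebra_simps)
qed

lemma lift_map_strict_mono:
  assumes "0 \<le> t" "t < s"
  shows "lift_map t < lift_map s"
proof -
  have "0 < (s - t) * (1 + V s)" using V_nonneg[of s] assms by simp
  then show ?thesis using lift_map_expand[of t s] assms by simp
qed

lemma continuous_lift_map: "continuous_on {0..} lift_map"
  using V unfolding lift_map_def admissible_def by (auto intro!: continuous_intros)

lemma lift_map_1: obtains q :: int where "q \<ge> 2" "lift_map 1 = of_int q"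
proof -
  obtain m :: nat where m: "m > 0" "V 1 = real m" using V by (auto simp: admissible_def)
  show ?thesis by (rule that[of "1 + int m"]) (use m in \<open>auto simp: lift_map_def\<close>)
qed

text \<open>The bound 1/2 serves twice: an integer of smaller modulus is \<open>0\<close>, and below
  it distances of lifted values are distances on the circle.\<close>

lemma lift_map_unif:
  obtains \<eta> where "\<eta> > 0"
    "\<And>s t. s \<in> {0..1} \<Longrightarrow> t \<in> {0..1} \<Longrightarrow> \<bar>s - t\<bar> < \<eta> \<Longrightarrow> \<bar>lift_map s - lift_map t\<bar> < 1/2"
proof -
  have "uniformly_continuous_on {0..1} lift_map"
    by (rule compact_uniformly_continuous) (auto intro: continuous_on_subset[OF continuous_lift_map])
  then have "\<exists>d>0. \<forall>s\<in>{0..1}. \<forall>t\<in>{0..1}. dist t s < d \<longrightarrow> dist (lift_map t) (lift_map s) < 1/2"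
    unfolding uniformly_continuous_on_def by (rule allE[of _ "1/2"]) simp
  then show ?thesis using that unfolding dist_real_def by blast
qed

text \<open>The lift runs from \<open>0\<close> to an integer \<open>q \<ge> 2\<close>, so it takes
  both values \<open>Rep_circle x\<close> and \<open>Rep_circle x + 1\<close> before reaching
  \<open>q\<close>.\<close>

lemma two_preimages:
  obtains a b where "circle_map V a = x" "circle_map V b = x" "a \<noteq> b"
proof -
  obtain q :: int where q: "q \<ge> 2" "lift_map 1 = of_int q" by (rule lift_map_1)
  have ex: "\<exists>s. 0 \<le> s \<and> s < 1 \<and> lift_map s = Rep_circle x + k" if "k \<in> {0,1}" for k :: real
  proof -
    have "\<exists>s\<ge>0. s \<le> 1 \<and> lift_map s = Rep_circle x + k"
      using that q Rep_circle_bounds[of x]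
      by (intro IVT' continuous_on_subset[OF continuous_lift_map]) (auto simp: lift_map_def)
    moreover have "lift_map 1 \<noteq> Rep_circle x + k"
      using that q Rep_circle_bounds[of x] by auto
    ultimately show ?thesis by (metis order_le_less)
  qed
  obtain s t where s: "0 \<le> s" "s < 1" "lift_map s = Rep_circle x"
    and t: "0 \<le> t" "t < 1" "lift_map t = Rep_circle x + 1"
    using ex[of 0] ex[of 1] by auto
  have "circle_map V (to_circle s) = x" "circle_map V (to_circle t) = x"
    using s t Rep_circle_bounds[of x] to_circle_eq_iff[of "Rep_circle x + 1" "Rep_circle x"]
    by (simp_all add: circle_map_eq Rep_to_circle frac_eq to_circle_Rep)
  moreover have "to_circle s \<noteq> to_circle t"
    using s t by (metis Rep_to_circle frac_eq add_cancel_left_right zero_neq_one)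
  ultimately show ?thesis using that by blast
qed

text \<open>Lifted values of points with the same image differ by an integer, which uniform
  continuity forces to be \<open>0\<close>. Points that are close across the cut at \<open>0\<close>
  are excluded by comparison with \<open>q\<close>.\<close>

lemma preimages_separated:
  obtains \<eta> where "\<eta> > 0"
    "\<And>a b. circle_map V a = circle_map V b \<Longrightarrow> dist a b < \<eta> \<Longrightarrow> a = b"
proof -
  obtain \<eta> where \<eta>: "\<eta> > 0"
    "\<And>s t. s \<in> {0..1} \<Longrightarrow> t \<in> {0..1} \<Longrightarrow> \<bar>s - t\<bar> < \<eta> \<Longrightarrow> \<bar>lift_map s - lift_map t\<bar> < 1/2"
    by (rule lift_map_unif) blast
  obtain q :: int where q: "q \<ge> 2" "lift_map 1 = of_int q" by (rule lift_map_1)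
  have int: "lift_map (Rep_circle a) - lift_map (Rep_circle b) \<in> \<int>"
    if "circle_map V a = circle_map V b" for a b
    using that by (simp add: circle_map_eq to_circle_eq_iff)
  have wrap: False if T: "circle_map V a = circle_map V b"
    and near: "1 - Rep_circle a + Rep_circle b < \<eta>" for a b
  proof -
    let ?s = "Rep_circle a" and ?t = "Rep_circle b"
    have "\<bar>lift_map 1 - lift_map ?s\<bar> < 1/2" "\<bar>lift_map ?t - lift_map 0\<bar> < 1/2"
      using near Rep_circle_bounds[of a] Rep_circle_bounds[of b] by (intro \<eta>(2); simp)+
    moreover have "lift_map ?s < lift_map 1" "lift_map 0 \<le> lift_map ?t"
      using Rep_circle_bounds[of a] Rep_circle_bounds[of b] lift_map_strict_mono
      by (auto simp: order_le_less)
    moreover have "lift_map 0 = 0" by (simp add: lift_map_def)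
    moreover obtain k where "lift_map ?s - lift_map ?t = of_int k"
      using int[OF T] by (auto elim: Ints_cases)
    \<comment> \<open>Monotonicity gives \<open>k < q\<close>, and less than 1/2 is lost at each end
      of the interval, so \<open>k\<close> would lie strictly between \<open>q - 1\<close> and
      \<open>q\<close>.\<close>
    ultimately have "real_of_int k < real_of_int q" "real_of_int q < real_of_int (k + 1)"
      using q by auto
    then show False unfolding of_int_less_iff by linarith
  qed
  show ?thesis
  proof (rule that[OF \<eta>(1)])
    fix a b assume T: "circle_map V a = circle_map V b" and d: "dist a b < \<eta>"
    show "a = b"
    proof (cases rule: dist_circle_cases[of a b])
      case 1
      then have "\<bar>lift_map (Rep_circle a) - lift_map (Rep_circle b)\<bar> < 1/2"
        using d Rep_circle_bounds[of a] Rep_circle_bounds[of b] by (intro \<eta>(2)) auto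
      moreover obtain k where "lift_map (Rep_circle a) - lift_map (Rep_circle b) = of_int k"
        using int[OF T] by (auto elim: Ints_cases)
      moreover from calculation have "k = 0" by linarith
      ultimately have "lift_map (Rep_circle a) = lift_map (Rep_circle b)" by simp
      then have "Rep_circle a = Rep_circle b"
        using lift_map_strict_mono Rep_circle_bounds by (metis linorder_less_linear order_less_irrefl)
      then show ?thesis by (simp add: Rep_circle_inject)
    next
      case 2
      then show ?thesis
        using wrap[of b a] T d Rep_circle_bounds[of a] Rep_circle_bounds[of b] by auto
    next
      case 3
      then show ?thesis
        using wrap[of a b] T d Rep_circle_bounds[of a] Rep_circle_bounds[of b] by auto
    qed
  qed
qed

text \<open>Two distinct preimages of a point cannot both be close to the neutral fixed point \<open>0\<close>.\<close>

lemma expanding_preimage: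
  obtains \<rho> lam where "\<rho> > 0" "0 < lam" "lam < 1"
    "\<And>x. \<exists>a\<in>circle_map V -` {x}. \<forall>b. dist a b < \<rho> \<longrightarrow> dist a b \<le> lam * dist x (circle_map V b)"
proof -
  obtain \<eta>1 where \<eta>1: "\<eta>1 > 0"
    "\<And>a b. circle_map V a = circle_map V b \<Longrightarrow> dist a b < \<eta>1 \<Longrightarrow> a = b"
    by (rule preimages_separated) blast
  obtain \<eta>2 where \<eta>2: "\<eta>2 > 0"
    "\<And>s t. s \<in> {0..1} \<Longrightarrow> t \<in> {0..1} \<Longrightarrow> \<bar>s - t\<bar> < \<eta>2 \<Longrightarrow> \<bar>lift_map s - lift_map t\<bar> < 1/2"
    by (rule lift_map_unif) blast
  define \<eta> where "\<eta> = min \<eta>1 \<eta>2"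
  have \<eta>: "\<eta> > 0" "\<eta> \<le> \<eta>1" "\<eta> \<le> \<eta>2" using \<eta>1 \<eta>2 by (auto simp: \<eta>_def)
  \<comment> \<open>Reciprocal of the smallest expansion factor at points
    \<open>\<ge> \<eta>/4\<close>, since \<open>V\<close> is increasing.\<close>
  define lam where "lam = 1 / (1 + V (\<eta>/4))"
  have Vp: "V (\<eta>/4) > 0" using \<eta> by (intro V_pos) simp
  have near: "\<exists>a\<in>circle_map V -` {x}. \<forall>b. dist a b < \<eta>/4 \<longrightarrow> dist a b \<le> lam * dist x (circle_map V b)" for x
  proof -
    obtain a' b' where ab': "circle_map V a' = x" "circle_map V b' = x" "a' \<noteq> b'"
      by (rule two_preimages)
    then have "dist a' b' \<ge> \<eta>1" using \<eta>1(2)[of a' b'] by fastforce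
    then have "dist a' (to_circle 0) \<ge> \<eta>/2 \<or> dist b' (to_circle 0) \<ge> \<eta>/2"
      using dist_triangle2[of a' b' "to_circle 0"] \<eta> by linarith
    then obtain a where a: "circle_map V a = x" "dist a (to_circle 0) \<ge> \<eta>/2" using ab' by blast
    define s where "s = Rep_circle a"
    have s: "0 \<le> s" "s < 1" "s \<ge> \<eta>/2" "1 - s \<ge> \<eta>/2"
      using a(2) Rep_circle_bounds[of a] dist_circle_le[of a "to_circle 0" 0]
        dist_circle_le[of a "to_circle 0" "-1"]
      by (auto simp: s_def Rep_to_circle)
    have "dist a b \<le> lam * dist x (circle_map V b)" if d: "dist a b < \<eta>/4" for b
    proof -
      define t where "t = Rep_circle b"
      have t: "0 \<le> t" "t < 1" using Rep_circle_bounds[of b] by (auto simp: t_def)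
      \<comment> \<open>\<open>a\<close> is at least \<open>\<eta>/2\<close> from the cut on either
        side, so a point within \<open>\<eta>/4\<close> of it cannot be reached across the
        cut.\<close>
      have dst: "dist a b = \<bar>s - t\<bar>"
        using d s t \<eta> by (cases rule: dist_circle_cases[of a b]) (auto simp: s_def t_def)
      have "\<bar>lift_map s - lift_map t\<bar> < 1/2"
        using d dst s t \<eta> by (intro \<eta>2(2)) auto
      then have Tdist: "dist x (circle_map V b) = \<bar>lift_map s - lift_map t\<bar>"
        using a dist_to_circle[of "lift_map s" "lift_map t"] by (auto simp: circle_map_eq s_def t_def)
      have expand: "(u - v) * (1 + V (\<eta>/4)) \<le> \<bar>lift_map u - lift_map v\<bar>"
        if "0 \<le> v" "v \<le> u" "\<eta>/4 \<le> u" for u v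
      proof -
        have "(u - v) * (1 + V (\<eta>/4)) \<le> (u - v) * (1 + V u)"
          using V_mono[of "\<eta>/4" u] that \<eta> by (intro mult_left_mono) auto
        then show ?thesis using lift_map_expand[of v u] that by linarith
      qed
      have "\<bar>s - t\<bar> * (1 + V (\<eta>/4)) \<le> \<bar>lift_map s - lift_map t\<bar>"
        using expand[of t s] expand[of s t] s t d dst \<eta> by (cases "t \<le> s") (auto simp: abs_minus_commute)
      then show ?thesis using Vp Tdist dst by (simp add: lam_def field_simps)
    qed
    then show ?thesis using a by blast
  qed
  show ?thesis
    by (rule that[of "\<eta>/4" lam]) (use \<eta> Vp near in \<open>auto simp: lam_def\<close>)
qed

text \<open>Compatibility speaks of infinite pre-orbits; surjectivity continues a single preimage
  backwards so that it can be applied.\<close>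

lemma preorbit_extension:
  assumes "circle_map V u = x"
  obtains X where "X \<in> pre_orbits (circle_map V) x" "X 1 = u"
proof -
  have "surj (circle_map V)" by (metis surj_def two_preimages)
  then have inv: "circle_map V (inv (circle_map V) y) = y" for y by (rule surj_f_inv_f)
  define X where "X n = (case n of 0 \<Rightarrow> x | Suc k \<Rightarrow> (inv (circle_map V) ^^ k) u)" for n
  show ?thesis
    by (rule that[of X]) (auto simp: X_def pre_orbits_def assms inv split: nat.split)
qed

text \<open>Below the separation scale of preimages, the partner of \<open>x\<^sub>1\<close> is determined by
  \<open>x\<^sub>1\<close>, so the bijection of infinite pre-orbits descends to the first preimages.\<close>

lemma compatible_pairing:
  assumes "compatible (circle_map V) \<Omega> \<omega>" and \<Omega>: "modulus_of_continuity \<Omega>"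
  obtains \<rho> C where "\<rho> > 0" "C > 0"
    "\<And>x y. dist x y < \<rho> \<Longrightarrow> \<exists>\<tau>. bij_betw \<tau> (circle_map V -` {x}) (circle_map V -` {y}) \<and>
       (\<forall>u\<in>circle_map V -` {x}. dist u (\<tau> u) \<le> dist x y \<and> C * \<omega> (dist u (\<tau> u)) \<le> \<Omega> (dist x y))"
proof -
  let ?T = "circle_map V"
  obtain \<rho>0 C where \<rho>0: "\<rho>0 > 0" "C > 0" and B: "\<And>x0 y0. dist x0 y0 < \<rho>0 \<Longrightarrow>
        (\<exists>B. bij_betw B (pre_orbits ?T x0) (pre_orbits ?T y0) \<and>
           (\<forall>x\<in>pre_orbits ?T x0. \<forall>k.
              dist (x k) (B x k) \<le> dist x0 y0 \<and>
              C * (\<Sum>j=1..k. \<omega> (dist (x j) (B x j)))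
                \<le> \<Omega> (dist x0 y0) - \<Omega> (dist (x k) (B x k))))"
    using assms(1) unfolding compatible_def by blast
  obtain \<eta> where \<eta>: "\<eta> > 0" "\<And>a b. ?T a = ?T b \<Longrightarrow> dist a b < \<eta> \<Longrightarrow> a = b"
    by (rule preimages_separated) blast
  \<comment> \<open>Two preimages with a common partner, or two partners of one preimage, lie within
    twice the distance of the base points; \<open>\<eta>/2\<close> keeps this below
    \<open>\<eta>\<close>.\<close>
  define \<rho> where "\<rho> = min \<rho>0 (\<eta>/2)"
  have pair: "\<exists>\<tau>. bij_betw \<tau> (?T -` {x}) (?T -` {y}) \<and>
       (\<forall>u\<in>?T -` {x}. dist u (\<tau> u) \<le> dist x y \<and> C * \<omega> (dist u (\<tau> u)) \<le> \<Omega> (dist x y))"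
    if d: "dist x y < \<rho>" for x y
  proof -
    obtain B where bij: "bij_betw B (pre_orbits ?T x) (pre_orbits ?T y)"
      and Bd: "\<And>X k. X \<in> pre_orbits ?T x \<Longrightarrow> dist (X k) (B X k) \<le> dist x y"
      and Bs: "\<And>X k. X \<in> pre_orbits ?T x \<Longrightarrow> C * (\<Sum>j=1..k. \<omega> (dist (X j) (B X j)))
                \<le> \<Omega> (dist x y) - \<Omega> (dist (X k) (B X k))"
      using B[of x y] d by (auto simp: \<rho>_def)
    have "\<exists>X. X \<in> pre_orbits ?T x \<and> X 1 = u" if "?T u = x" for u
      using preorbit_extension[OF that] by blast
    then obtain E where E: "\<And>u. ?T u = x \<Longrightarrow> E u \<in> pre_orbits ?T x" "\<And>u. ?T u = x \<Longrightarrow> E u 1 = u"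
      by metis
    define \<tau> where "\<tau> u = B (E u) 1" for u
    have first: "?T (X 1) = z" if "X \<in> pre_orbits ?T z" for X z
      using that by (simp add: pre_orbits_def)
    have BE: "B (E u) \<in> pre_orbits ?T y" if "?T u = x" for u
      using bij E(1)[OF that] by (auto simp: bij_betw_def)
    have \<tau>T: "?T (\<tau> u) = y" if "?T u = x" for u
      using first BE[OF that] by (simp add: \<tau>_def)
    have \<tau>d: "dist u (\<tau> u) \<le> dist x y" if "?T u = x" for u
      using Bd[OF E(1)[OF that], of 1] E(2)[OF that] by (simp add: \<tau>_def)
    have \<tau>\<omega>: "C * \<omega> (dist u (\<tau> u)) \<le> \<Omega> (dist x y)" if "?T u = x" for u
    proof -
      have "0 \<le> \<Omega> (dist u (\<tau> u))" using \<Omega> by (cases "dist u (\<tau> u) = 0")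
          (auto simp: modulus_of_continuity_def less_eq_real_def)
      then show ?thesis
        using Bs[OF E(1)[OF that], of 1] E(2)[OF that] by (simp add: \<tau>_def)
    qed
    have "bij_betw \<tau> (?T -` {x}) (?T -` {y})"
      unfolding bij_betw_def
    proof (intro conjI inj_onI subset_antisym subsetI)
      fix u v assume uv: "u \<in> ?T -` {x}" "v \<in> ?T -` {x}" "\<tau> u = \<tau> v"
      then have "dist u v < \<eta>"
        using dist_triangle2[of u v "\<tau> u"] \<tau>d[of u] \<tau>d[of v] d by (simp add: \<rho>_def)
      then show "u = v" using \<eta>(2) uv by auto
    next
      fix w assume "w \<in> \<tau> ` (?T -` {x})"
      then show "w \<in> ?T -` {y}" using \<tau>T by auto
    next
      fix w assume "w \<in> ?T -` {y}"
      then obtain Y where Y: "Y \<in> pre_orbits ?T y" "Y 1 = w" and w: "?T w = y"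
        using preorbit_extension[of w y] by auto
      then obtain X where X: "X \<in> pre_orbits ?T x" "B X = Y"
        using bij unfolding bij_betw_def by (metis imageE)
      \<comment> \<open>\<open>X\<close> need not be the chosen pre-orbit \<open>E (X 1)\<close>.
        Still, \<open>w\<close> and \<open>\<tau> (X 1)\<close> are preimages of \<open>y\<close>
        that are both close to \<open>X 1\<close>, hence equal.\<close>
      have Tu: "?T (X 1) = x" using first X by simp
      have "dist (X 1) w \<le> dist x y" using Bd[OF X(1), of 1] X Y by simp
      then have "dist w (\<tau> (X 1)) < \<eta>"
        using \<tau>d[OF Tu] dist_triangle3[of w "\<tau> (X 1)" "X 1"] d by (simp add: \<rho>_def)
      then have "w = \<tau> (X 1)" using \<eta>(2) w \<tau>T[OF Tu] by simp
      then show "w \<in> \<tau> ` (?T -` {x})" using Tu by blast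
    qed
    then show ?thesis using \<tau>d \<tau>\<omega> by (intro exI[of _ \<tau>]) auto
  qed
  show ?thesis
    by (rule that[of \<rho> C]) (use \<rho>0 \<eta> pair in \<open>auto simp: \<rho>_def\<close>)
qed

end

section \<open>Functions with a modulus of continuity\<close>

lemma modulus_nonneg: "modulus_of_continuity W \<Longrightarrow> 0 \<le> s \<Longrightarrow> 0 \<le> W s"
  by (cases "s = 0") (auto simp: modulus_of_continuity_def less_eq_real_def)

lemma modulus_mono: "modulus_of_continuity W \<Longrightarrow> 0 \<le> s \<Longrightarrow> s \<le> t \<Longrightarrow> W s \<le> W t"
  by (auto simp: modulus_of_continuity_def monotone_on_def)

lemma modulus_small:
  assumes "modulus_of_continuity W" "e > 0"
  obtains d where "d > 0" "\<And>t. 0 \<le> t \<Longrightarrow> t \<le> d \<Longrightarrow> W t < e"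
proof -
  have "\<exists>d>0. \<forall>t\<in>{0..}. dist t 0 < d \<longrightarrow> dist (W t) (W 0) < e"
    using assms unfolding modulus_of_continuity_def continuous_on_iff by (metis atLeast_iff order_refl)
  then obtain d where "d > 0" "\<And>t. t \<ge> 0 \<Longrightarrow> t < d \<Longrightarrow> \<bar>W t\<bar> < e"
    using assms by (auto simp: modulus_of_continuity_def dist_real_def)
  then show ?thesis by (intro that[of "d/2"]) (auto simp: abs_less_iff)
qed

text \<open>One constant for the sup norm and the seminorm together. The relational form avoids real
  suprema and agrees with \<open>modulus_norm\<close> up to a factor 2.\<close>

definition modulus_bound ::
    "(real \<Rightarrow> real) \<Rightarrow> (circle \<Rightarrow> 'b::real_normed_vector) \<Rightarrow> real \<Rightarrow> bool" where
  "modulus_bound W \<phi> A \<longleftrightarrow>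
     (\<forall>x. norm (\<phi> x) \<le> A) \<and> (\<forall>x y. norm (\<phi> x - \<phi> y) \<le> A * W (dist x y))"

lemma modulus_bound_nonneg: "modulus_bound W \<phi> A \<Longrightarrow> 0 \<le> A"
  unfolding modulus_bound_def by (meson norm_ge_zero order_trans)

lemma modulus_bound_mono:
  assumes "modulus_bound W \<phi> A" "A \<le> B" "modulus_of_continuity W"
  shows "modulus_bound W \<phi> B"
  using assms modulus_nonneg[OF assms(3) zero_le_dist]
  unfolding modulus_bound_def by (meson mult_right_mono order_trans)

lemma modulus_bound_add:
  assumes "modulus_bound W \<phi> A" "modulus_bound W \<psi> B"
  shows "modulus_bound W (\<lambda>x. \<phi> x + \<psi> x) (A + B)"
  unfolding modulus_bound_def
proof (intro conjI allI)
  fix x y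
  show "norm (\<phi> x + \<psi> x) \<le> A + B"
    using assms by (meson modulus_bound_def norm_triangle_mono)
  have "norm ((\<phi> x - \<phi> y) + (\<psi> x - \<psi> y)) \<le> A * W (dist x y) + B * W (dist x y)"
    using assms by (meson modulus_bound_def norm_triangle_mono)
  then show "norm (\<phi> x + \<psi> x - (\<phi> y + \<psi> y)) \<le> (A + B) * W (dist x y)"
    by (simp add: algebra_simps)
qed

lemma modulus_bound_const:
  "modulus_of_continuity W \<Longrightarrow> modulus_bound W (\<lambda>_. c) (norm c)"
  by (simp add: modulus_bound_def modulus_nonneg)

lemma modulus_bound_mult:
  fixes \<phi> \<psi> :: "circle \<Rightarrow> 'b::real_normed_algebra"
  assumes \<phi>: "modulus_bound W \<phi> A" and \<psi>: "modulus_bound W \<psi> B" and W: "modulus_of_continuity W"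
  shows "modulus_bound W (\<lambda>x. \<phi> x * \<psi> x) (2 * A * B)"
  unfolding modulus_bound_def
proof (intro conjI allI)
  fix x y :: circle
  have nn: "0 \<le> A" "0 \<le> B" "0 \<le> W (dist x y)"
    using \<phi> \<psi> W modulus_bound_nonneg modulus_nonneg zero_le_dist by blast+
  have m: "norm (a * b) \<le> s * t" if "norm a \<le> s" "norm b \<le> t" for a b :: 'b and s t
  proof -
    have "norm (a * b) \<le> norm a * norm b" by (rule norm_mult_ineq)
    also have "\<dots> \<le> s * t" using that norm_ge_zero[of a] norm_ge_zero[of b]
      by (intro mult_mono) linarith+
    finally show ?thesis .
  qed
  have "norm (\<phi> x * \<psi> x) \<le> A * B" using \<phi> \<psi> by (auto simp: modulus_bound_def intro: m)
  moreover have "0 \<le> A * B" using nn by simp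
  ultimately show "norm (\<phi> x * \<psi> x) \<le> 2 * A * B" by linarith
  have "norm (\<phi> x * (\<psi> x - \<psi> y)) \<le> A * (B * W (dist x y))"
    "norm ((\<phi> x - \<phi> y) * \<psi> y) \<le> (A * W (dist x y)) * B"
    using \<phi> \<psi> by (auto simp: modulus_bound_def intro: m)
  then have "norm (\<phi> x * (\<psi> x - \<psi> y) + (\<phi> x - \<phi> y) * \<psi> y) \<le> A * (B * W (dist x y)) + (A * W (dist x y)) * B"
    by (rule norm_triangle_mono)
  then show "norm (\<phi> x * \<psi> x - \<phi> y * \<psi> y) \<le> 2 * A * B * W (dist x y)"
    by (simp add: algebra_simps)
qed

lemma modulus_bound_continuous:
  assumes \<phi>: "modulus_bound W \<phi> A" and W: "modulus_of_continuity W"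
  shows "continuous_on UNIV \<phi>"
  unfolding continuous_on_iff
proof (intro ballI allI impI)
  fix x and e :: real assume "e > 0"
  have A: "A \<ge> 0" using \<phi> by (rule modulus_bound_nonneg)
  then have "e / (A + 1) > 0" using \<open>e > 0\<close> by simp
  then obtain d where d: "d > 0" "\<And>t. 0 \<le> t \<Longrightarrow> t \<le> d \<Longrightarrow> W t < e / (A + 1)"
    by (rule modulus_small[OF W]) blast
  have "dist (\<phi> y) (\<phi> x) < e" if "dist y x < d" for y
  proof -
    have "dist (\<phi> y) (\<phi> x) \<le> A * W (dist y x)"
      using \<phi> by (simp add: modulus_bound_def dist_norm)
    also have "\<dots> \<le> (A + 1) * W (dist y x)"
      using modulus_nonneg[OF W, of "dist y x"] by (simp add: mult_right_mono)
    also have "\<dots> < (A + 1) * (e / (A + 1))"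
      using d(2)[of "dist y x"] that A by (intro mult_strict_left_mono) auto
    finally show ?thesis using A by simp
  qed
  then show "\<exists>d>0. \<forall>y\<in>UNIV. dist y x < d \<longrightarrow> dist (\<phi> y) (\<phi> x) < e" using d(1) by blast
qed

lemma modulus_bound_quotient:
  assumes "modulus_bound W \<phi> A" "modulus_of_continuity W" "q \<in> modulus_quotients W \<phi>"
  shows "q \<le> A"
proof -
  obtain x y where q: "q = norm (\<phi> x - \<phi> y) / W (dist x y)" "x \<noteq> y"
    using assms(3) by (auto simp: modulus_quotients_def)
  then have "W (dist x y) > 0" using assms(2) by (simp add: modulus_of_continuity_def)
  then show ?thesis using assms(1) q by (simp add: modulus_bound_def divide_le_eq)
qed

lemma modulus_bound_in_space:
  assumes "modulus_bound W \<phi> A" "modulus_of_continuity W"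
  shows "\<phi> \<in> modulus_space W"
  using modulus_bound_continuous[OF assms] modulus_bound_quotient[OF assms]
  by (auto simp: modulus_space_def bdd_above_def)

lemma modulus_bound_norm_le:
  assumes "modulus_bound W \<phi> A" "modulus_of_continuity W"
  shows "modulus_norm W \<phi> \<le> 2 * A"
proof -
  \<comment> \<open>The least-upper-bound rule for real \<open>Sup\<close> requires a nonempty set
    of quotients.\<close>
  have "to_circle 0 \<noteq> to_circle (1/2)"
    using dist_to_circle[of 0 "1/2"] by auto
  then have "modulus_quotients W \<phi> \<noteq> {}" by (auto simp: modulus_quotients_def)
  then have "modulus_seminorm W \<phi> \<le> A"
    unfolding modulus_seminorm_def using modulus_bound_quotient[OF assms] by (rule cSup_least)
  moreover have "(SUP x. norm (\<phi> x)) \<le> A"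
    using assms(1) by (intro cSUP_least) (auto simp: modulus_bound_def)
  ultimately show ?thesis by (simp add: modulus_norm_def)
qed

text \<open>Compactness makes the supremum of the norm genuine. Together with
  \<open>modulus_bound_norm_le\<close> this lets the whole proof run on \<open>modulus_bound\<close>
  and return to the norm at the end.\<close>

lemma modulus_space_bound:
  assumes \<phi>: "\<phi> \<in> modulus_space W" and W: "modulus_of_continuity W"
  shows "modulus_bound W \<phi> (modulus_norm W \<phi>)"
proof -
  have "compact ((\<lambda>x. norm (\<phi> x)) ` UNIV)"
    using \<phi> by (intro compact_continuous_image compact_circle continuous_on_norm) (simp add: modulus_space_def)
  then have bdd: "bdd_above (range (\<lambda>x. norm (\<phi> x)))"
    by (simp add: bounded_imp_bdd_above compact_imp_bounded)
  have sup: "norm (\<phi> x) \<le> (SUP x. norm (\<phi> x))" for x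
    by (rule cSUP_upper[OF _ bdd]) simp
  have lip: "norm (\<phi> x - \<phi> y) \<le> modulus_seminorm W \<phi> * W (dist x y)" for x y
  proof (cases "x = y")
    case True
    then show ?thesis using W by (simp add: modulus_of_continuity_def)
  next
    case False
    then have "norm (\<phi> x - \<phi> y) / W (dist x y) \<le> modulus_seminorm W \<phi>"
      unfolding modulus_seminorm_def using \<phi>
      by (intro cSup_upper) (auto simp: modulus_quotients_def modulus_space_def)
    then show ?thesis using False W by (simp add: modulus_of_continuity_def divide_le_eq)
  qed
  have sn: "0 \<le> (SUP x. norm (\<phi> x))" using sup norm_ge_zero order_trans by blast
  have half: "dist (to_circle 0) (to_circle (1/2)) = 1/2"
    using dist_to_circle[of 0 "1/2"] by simp
  \<comment> \<open>The seminorm is nonnegative because it bounds the quotient at one pair of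
    distinct points.\<close>
  have "0 \<le> modulus_seminorm W \<phi> * W (1/2)"
    using lip[of "to_circle 0" "to_circle (1/2)"] unfolding half by (rule order_trans[OF norm_ge_zero])
  moreover have "W (1/2) > 0" using W by (simp add: modulus_of_continuity_def)
  ultimately have "0 \<le> modulus_seminorm W \<phi>" by (simp add: zero_le_mult_iff)
  then have le: "modulus_seminorm W \<phi> \<le> modulus_norm W \<phi>" "(SUP x. norm (\<phi> x)) \<le> modulus_norm W \<phi>"
    using sn by (auto simp: modulus_norm_def)
  show ?thesis
    unfolding modulus_bound_def using sup lip le modulus_nonneg[OF W zero_le_dist]
    by (meson mult_right_mono order_trans)
qed

text \<open>Takes the place of completeness of the function space: summable bounds pass to the sum,
  as the Neumann series needs.\<close>

lemma modulus_bound_suminf: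
  fixes \<phi> :: "nat \<Rightarrow> circle \<Rightarrow> 'b::banach"
  assumes \<phi>: "\<And>k. modulus_bound W (\<phi> k) (a k)" and a: "summable a"
  shows "summable (\<lambda>k. \<phi> k x)" "modulus_bound W (\<lambda>x. \<Sum>k. \<phi> k x) (suminf a)"
proof -
  have sn: "summable (\<lambda>k. norm (\<phi> k x))" for x
    using \<phi> by (intro summable_comparison_test'[OF a, of 0]) (simp add: modulus_bound_def)
  then show s: "summable (\<lambda>k. \<phi> k x)" for x by (rule summable_norm_cancel)
  show "modulus_bound W (\<lambda>x. \<Sum>k. \<phi> k x) (suminf a)"
    unfolding modulus_bound_def
  proof (intro conjI allI)
    fix x y
    have "norm (\<Sum>k. \<phi> k x) \<le> (\<Sum>k. norm (\<phi> k x))" by (rule summable_norm[OF sn])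
    also have "\<dots> \<le> suminf a" using \<phi> by (intro suminf_le sn a) (simp add: modulus_bound_def)
    finally show "norm (\<Sum>k. \<phi> k x) \<le> suminf a" .
    have le: "norm (\<phi> k x - \<phi> k y) \<le> a k * W (dist x y)" for k
      using \<phi> by (simp add: modulus_bound_def)
    have sW: "summable (\<lambda>k. a k * W (dist x y))" using a by (rule summable_mult2)
    have sd: "summable (\<lambda>k. norm (\<phi> k x - \<phi> k y))"
      using le by (intro summable_comparison_test'[OF sW, of 0]) simp
    have "norm ((\<Sum>k. \<phi> k x) - (\<Sum>k. \<phi> k y)) = norm (\<Sum>k. \<phi> k x - \<phi> k y)"
      by (simp add: suminf_diff s)
    also have "\<dots> \<le> (\<Sum>k. norm (\<phi> k x - \<phi> k y))" by (rule summable_norm[OF sd])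
    also have "\<dots> \<le> (\<Sum>k. a k * W (dist x y))" by (intro suminf_le sd sW le)
    also have "\<dots> = suminf a * W (dist x y)" by (rule suminf_mult2[OF a, symmetric])
    finally show "norm ((\<Sum>k. \<phi> k x) - (\<Sum>k. \<phi> k y)) \<le> suminf a * W (dist x y)" .
  qed
qed

section \<open>Lasota-Yorke inequality for a normalised operator\<close>

lemma transfer_op_lincomb:
  "transfer_op T f (\<lambda>y. \<Sum>s\<in>S. \<psi> s y *\<^sub>R c s) x = (\<Sum>s\<in>S. transfer_op T f (\<psi> s) x *\<^sub>R c s)"
  unfolding transfer_op_def
  by (simp add: scaleR_sum_right scaleR_sum_left) (rule sum.swap)

text \<open>Reduces iterates of a vector-valued function to iterates of real coefficient functions,
  for which convergence is known.\<close>

lemma transfer_op_pow_lincomb: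
  "(transfer_op T f ^^ n) (\<lambda>y. \<Sum>s\<in>S. \<psi> s y *\<^sub>R c s) x
     = (\<Sum>s\<in>S. (transfer_op T f ^^ n) (\<psi> s) x *\<^sub>R c s)"
proof (induction n arbitrary: x)
  case (Suc n)
  then have "(transfer_op T f ^^ n) (\<lambda>y. \<Sum>s\<in>S. \<psi> s y *\<^sub>R c s)
     = (\<lambda>y. \<Sum>s\<in>S. (transfer_op T f ^^ n) (\<psi> s) y *\<^sub>R c s)" by blast
  then show ?case by (simp add: transfer_op_lincomb)
qed simp

lemma transfer_op_add:
  "transfer_op T f (\<lambda>y. \<phi> y + \<psi> y) = (\<lambda>x. transfer_op T f \<phi> x + transfer_op T f \<psi> x)"
  by (simp add: fun_eq_iff transfer_op_def scaleR_add_right sum.distrib)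

lemma transfer_op_diff:
  "transfer_op T f (\<lambda>y. \<phi> y - \<psi> y) = (\<lambda>x. transfer_op T f \<phi> x - transfer_op T f \<psi> x)"
  by (simp add: fun_eq_iff transfer_op_def scaleR_diff_right sum_subtractf)

lemma transfer_op_cmult:
  fixes \<phi> :: "circle \<Rightarrow> 'b::real_algebra"
  shows "transfer_op T f (\<lambda>y. c * \<phi> y) = (\<lambda>x. c * transfer_op T f \<phi> x)"
  by (simp add: fun_eq_iff transfer_op_def sum_distrib_left)

lemma transfer_op_pow_diff:
  "(transfer_op T f ^^ n) (\<lambda>y. \<phi> y - \<psi> y)
     = (\<lambda>x. (transfer_op T f ^^ n) \<phi> x - (transfer_op T f ^^ n) \<psi> x)"
proof (induction n)
  case (Suc n)
  then show ?case by (simp add: transfer_op_diff)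
qed simp

text \<open>What the conjugated operator retains. By \<open>weight_sum\<close> it is an average. The
  distortion in \<open>pairing\<close> is relative to the weight at \<open>\<tau> u\<close>, so it
  adds up to \<open>K * \<Omega> d\<close>; \<open>\<rho> \<le> 1/2\<close> keeps paired distances
  in the range of \<open>vanishes_orderly\<close>.\<close>

locale normalised_transfer =
  fixes T :: "circle \<Rightarrow> circle" and F :: "circle \<Rightarrow> real" and \<Omega> :: "real \<Rightarrow> real"
    and \<rho> lam c K :: real
  assumes fin: "finite (T -` {x})"
    and \<Omega>: "modulus_of_continuity \<Omega>" "vanishes_orderly \<Omega>"
    and const: "\<rho> > 0" "\<rho> \<le> 1/2" "0 < lam" "lam < 1" "c > 0" "K \<ge> 0"
    and weight_ge: "c \<le> exp (F x)"
    and weight_sum: "(\<Sum>u\<in>T -` {x}. exp (F u)) = 1"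
    and pairing: "dist x y < \<rho> \<Longrightarrow> \<exists>\<tau>. bij_betw \<tau> (T -` {x}) (T -` {y}) \<and>
       (\<forall>u\<in>T -` {x}. dist u (\<tau> u) \<le> dist x y \<and>
          \<bar>exp (F u) - exp (F (\<tau> u))\<bar> \<le> K * \<Omega> (dist x y) * exp (F (\<tau> u))) \<and>
       (\<exists>u\<in>T -` {x}. dist u (\<tau> u) \<le> lam * dist x y)"
    and converges: "continuous_on UNIV \<psi> \<Longrightarrow>
       \<exists>w. uniform_limit UNIV (\<lambda>n. (transfer_op T F ^^ n) \<psi>) (\<lambda>_. w::real) sequentially"
begin

abbreviation P :: "(circle \<Rightarrow> 'b::real_normed_vector) \<Rightarrow> circle \<Rightarrow> 'b" where
  "P \<equiv> transfer_op T F"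

lemma P_const: "P (\<lambda>_. w) = (\<lambda>_. w)"
  using weight_sum by (simp add: transfer_op_def fun_eq_iff flip: scaleR_sum_left)

lemma P_pow_const: "(P ^^ n) (\<lambda>_. w) = (\<lambda>_. w)"
  by (induction n) (simp_all add: P_const)

lemma P_sup:
  assumes "\<And>x. norm (\<phi> x) \<le> M"
  shows "norm (P \<phi> x) \<le> M"
proof -
  have "norm (P \<phi> x) \<le> (\<Sum>u\<in>T -` {x}. exp (F u) * M)"
    unfolding transfer_op_def using assms by (intro sum_norm_le) simp
  also have "\<dots> = M" by (simp add: weight_sum flip: sum_distrib_right)
  finally show ?thesis .
qed

lemma P_pow_sup:
  assumes "\<And>x. norm (\<phi> x) \<le> M"
  shows "norm ((P ^^ n) \<phi> x) \<le> M"
proof (induction n arbitrary: x)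
  case (Suc n)
  then show ?case using P_sup[of "(P ^^ n) \<phi>"] by simp
qed (simp add: assms)

lemma c_le_1: "c \<le> 1"
proof -
  obtain u where u: "u \<in> T -` {undefined}"
    using weight_sum[of undefined] by (metis all_not_in_conv sum.empty zero_neq_one)
  have "exp (F u) \<le> (\<Sum>u\<in>T -` {undefined}. exp (F u))"
    using u fin by (intro member_le_sum) auto
  then show ?thesis using weight_ge[of u] by (simp only: weight_sum)
qed

text \<open>Each application of the operator hands at least the fraction \<open>c\<close> of the weight
  to a pair of preimages contracted by the factor \<open>lam\<close>.\<close>

lemma lasota_yorke_pow:
  assumes M: "\<And>x. norm (\<phi> x) \<le> M"
    and A: "A \<ge> 0" "\<And>x y. dist x y < \<rho> \<Longrightarrow> norm (\<phi> x - \<phi> y) \<le> A * \<Omega> (dist x y)"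
    and "dist x y < \<rho>"
  shows "norm ((P ^^ n) \<phi> x - (P ^^ n) \<phi> y)
    \<le> A * (\<Omega> (dist x y) - c ^ n * (\<Omega> (dist x y) - \<Omega> (lam ^ n * dist x y)))
       + real n * K * M * \<Omega> (dist x y)"
  using \<open>dist x y < \<rho>\<close>
proof (induction n arbitrary: x y)
  case 0
  then show ?case using A by simp
next
  case (Suc n)
  define \<psi> where "\<psi> = (P ^^ n) \<phi>"
  define d where "d = dist x y"
  have M0: "0 \<le> M" using M[of x] norm_ge_zero order_trans by blast
  have \<psi>M: "norm (\<psi> u) \<le> M" for u unfolding \<psi>_def using M by (rule P_pow_sup)
  obtain \<tau> u0 where \<tau>: "bij_betw \<tau> (T -` {x}) (T -` {y})"
    and near: "\<And>u. u \<in> T -` {x} \<Longrightarrow> dist u (\<tau> u) \<le> d"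
    and weight: "\<And>u. u \<in> T -` {x} \<Longrightarrow> \<bar>exp (F u) - exp (F (\<tau> u))\<bar> \<le> K * \<Omega> d * exp (F (\<tau> u))"
    and u0: "u0 \<in> T -` {x}" "dist u0 (\<tau> u0) \<le> lam * d"
    using pairing[OF Suc.prems] unfolding d_def by blast
  have d: "0 \<le> d" "d < \<rho>" using Suc.prems by (auto simp: d_def)
  define S where "S = A * \<Omega> d + real n * K * M * \<Omega> d"
  \<comment> \<open>The saving at the contracted pair: at distance at most \<open>lam * d\<close>,
    the inductive gain after \<open>n\<close> steps is measured at
    \<open>lam ^ Suc n * d\<close>.\<close>
  define \<delta> where "\<delta> = A * c ^ n * (\<Omega> d - \<Omega> (lam ^ Suc n * d))"
  have nn: "0 \<le> \<Omega> s" if "0 \<le> s" for s using modulus_nonneg[OF \<Omega>(1) that] .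
  have pw: "0 \<le> c ^ n" "c ^ n \<le> 1" using c_le_1 const by (auto intro: power_le_one)
  have lamd: "lam ^ k * s \<le> s" "0 \<le> lam ^ k * s" if "0 \<le> s" for k s
    using const that by (auto intro!: mult_left_le_one_le power_le_one)
  have \<delta>0: "0 \<le> \<delta>"
    unfolding \<delta>_def using A(1) pw modulus_mono[OF \<Omega>(1) lamd(2)[OF d(1)] lamd(1)[OF d(1)], of "Suc n"]
    by (intro mult_nonneg_nonneg) auto
  have pair: "norm (\<psi> u - \<psi> (\<tau> u)) \<le> S - (if u = u0 then \<delta> else 0)" if u: "u \<in> T -` {x}" for u
  proof -
    define e where "e = dist u (\<tau> u)"
    have e: "0 \<le> e" "e \<le> d" using near[OF u] by (auto simp: e_def)
    have \<Omega>e: "\<Omega> e \<le> \<Omega> d" using modulus_mono[OF \<Omega>(1) e] .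
    have IH: "norm (\<psi> u - \<psi> (\<tau> u)) \<le> A * (\<Omega> e - c ^ n * (\<Omega> e - \<Omega> (lam ^ n * e))) + real n * K * M * \<Omega> e"
      using Suc.IH[of u "\<tau> u"] e d by (simp add: \<psi>_def e_def)
    have K: "real n * K * M * \<Omega> e \<le> real n * K * M * \<Omega> d"
      using \<Omega>e const M0 by (intro mult_left_mono) auto
    \<comment> \<open>As a convex combination the bound is visibly increasing in both values of
      \<open>\<Omega>\<close>, so each can be replaced by its upper bound.\<close>
    have drop: "A * (\<Omega> e - c ^ n * (\<Omega> e - \<Omega> (lam ^ n * e))) = A * ((1 - c ^ n) * \<Omega> e + c ^ n * \<Omega> (lam ^ n * e))"
      by (simp add: algebra_simps)
    have b: "\<Omega> (lam ^ n * e) \<le> (if u = u0 then \<Omega> (lam ^ Suc n * d) else \<Omega> d)"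
    proof (cases "u = u0")
      case True
      then have "lam ^ n * e \<le> lam ^ n * (lam * d)"
        using u0 const by (intro mult_left_mono) (auto simp: e_def)
      then have "lam ^ n * e \<le> lam ^ Suc n * d" by (simp add: ac_simps)
      then show ?thesis using True modulus_mono[OF \<Omega>(1)] lamd[OF e(1)] by simp
    next
      case False
      have "lam ^ n * e \<le> d" using lamd(1)[OF e(1), of n] e by linarith
      then show ?thesis using False modulus_mono[OF \<Omega>(1)] lamd[OF e(1)] by simp
    qed
    have "A * ((1 - c ^ n) * \<Omega> e + c ^ n * \<Omega> (lam ^ n * e))
        \<le> A * ((1 - c ^ n) * \<Omega> d + c ^ n * (if u = u0 then \<Omega> (lam ^ Suc n * d) else \<Omega> d))"
      using \<Omega>e b pw A(1) by (intro mult_left_mono add_mono) auto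
    also have "\<dots> = A * \<Omega> d - (if u = u0 then \<delta> else 0)"
      by (simp add: \<delta>_def algebra_simps)
    finally show ?thesis using IH K drop by (simp add: S_def)
  qed
  have reindex: "P \<psi> y = (\<Sum>u\<in>T -` {x}. exp (F (\<tau> u)) *\<^sub>R \<psi> (\<tau> u))"
    unfolding transfer_op_def by (rule sum.reindex_bij_betw[OF \<tau>, symmetric])
  have sum1: "(\<Sum>u\<in>T -` {x}. exp (F (\<tau> u))) = 1"
    using sum.reindex_bij_betw[OF \<tau>, of "\<lambda>u. exp (F u)"] weight_sum by simp
  \<comment> \<open>Differences of \<open>\<psi>\<close> carry the weights at \<open>x\<close>,
    differences of weights carry values of \<open>\<psi>\<close> over \<open>y\<close>; either
    family of weights sums to \<open>1\<close>.\<close>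
  have "P \<psi> x - P \<psi> y = (\<Sum>u\<in>T -` {x}. exp (F u) *\<^sub>R (\<psi> u - \<psi> (\<tau> u))
      + (exp (F u) - exp (F (\<tau> u))) *\<^sub>R \<psi> (\<tau> u))"
    unfolding reindex unfolding transfer_op_def
    by (simp add: sum_subtractf[symmetric] algebra_simps)
  also have "norm \<dots> \<le> (\<Sum>u\<in>T -` {x}. exp (F u) * (S - (if u = u0 then \<delta> else 0)) + K * \<Omega> d * exp (F (\<tau> u)) * M)"
  proof (rule sum_norm_le)
    fix u assume u: "u \<in> T -` {x}"
    have "norm (exp (F u) *\<^sub>R (\<psi> u - \<psi> (\<tau> u))) \<le> exp (F u) * (S - (if u = u0 then \<delta> else 0))"
      using pair[OF u] by (simp only: norm_scaleR abs_exp_cancel) (intro mult_left_mono; simp)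
    moreover have "norm ((exp (F u) - exp (F (\<tau> u))) *\<^sub>R \<psi> (\<tau> u)) \<le> (K * \<Omega> d * exp (F (\<tau> u))) * M"
      using weight[OF u] \<psi>M[of "\<tau> u"] by (simp only: norm_scaleR) (intro mult_mono; simp add: order_trans[OF abs_ge_zero])
    ultimately show "norm (exp (F u) *\<^sub>R (\<psi> u - \<psi> (\<tau> u)) + (exp (F u) - exp (F (\<tau> u))) *\<^sub>R \<psi> (\<tau> u))
        \<le> exp (F u) * (S - (if u = u0 then \<delta> else 0)) + K * \<Omega> d * exp (F (\<tau> u)) * M"
      by (rule norm_triangle_mono)
  qed
  also have "\<dots> = (\<Sum>u\<in>T -` {x}. exp (F u) * S) - (\<Sum>u\<in>T -` {x}. if u = u0 then exp (F u) * \<delta> else 0)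
      + (\<Sum>u\<in>T -` {x}. exp (F (\<tau> u)) * (K * \<Omega> d * M))"
    unfolding sum.distrib[symmetric] sum_subtractf[symmetric]
    by (rule sum.cong) (auto simp: algebra_simps)
  also have "\<dots> = S - exp (F u0) * \<delta> + K * \<Omega> d * M"
    using u0 fin by (simp add: sum.delta weight_sum sum1 flip: sum_distrib_right)
  \<comment> \<open>Keeping only the fraction \<open>c\<close> of the weight at \<open>u0\<close>
    turns \<open>c ^ n\<close> into \<open>c ^ Suc n\<close>.\<close>
  also have "\<dots> \<le> S - c * \<delta> + K * \<Omega> d * M"
    using weight_ge[of u0] \<delta>0 by (simp add: mult_right_mono)
  also have "\<dots> = A * (\<Omega> d - c ^ Suc n * (\<Omega> d - \<Omega> (lam ^ Suc n * d))) + real (Suc n) * K * M * \<Omega> d"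
    by (simp add: S_def \<delta>_def algebra_simps)
  finally show ?case by (simp add: \<psi>_def d_def)
qed

end

section \<open>From the inequality to exponential decay\<close>

context normalised_transfer
begin

text \<open>Limited to distances below \<open>\<rho>\<close>, where preimages are paired, and free
  of the sup norm, which evolves differently under \<open>P\<close>.\<close>

definition local_bound :: "(circle \<Rightarrow> 'b::real_normed_vector) \<Rightarrow> real \<Rightarrow> bool" where
  "local_bound \<phi> A \<longleftrightarrow> (\<forall>x y. dist x y < \<rho> \<longrightarrow> norm (\<phi> x - \<phi> y) \<le> A * \<Omega> (dist x y))"

lemma \<Omega>_nonneg: "0 \<le> s \<Longrightarrow> 0 \<le> \<Omega> s"
  using modulus_nonneg[OF \<Omega>(1)] .

lemma local_boundD: "local_bound \<phi> A \<Longrightarrow> dist x y < \<rho> \<Longrightarrow> norm (\<phi> x - \<phi> y) \<le> A * \<Omega> (dist x y)"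
  by (simp add: local_bound_def)

lemma local_bound_mono: "local_bound \<phi> A \<Longrightarrow> A \<le> B \<Longrightarrow> local_bound \<phi> B"
  unfolding local_bound_def by (meson \<Omega>_nonneg mult_right_mono order_trans zero_le_dist)

lemma modulus_bound_local: "modulus_bound \<Omega> \<phi> A \<Longrightarrow> local_bound \<phi> A"
  by (simp add: modulus_bound_def local_bound_def)

text \<open>Pairs at distance at least \<open>\<rho>\<close> are handled by the trivial bound
  \<open>2 * M\<close> and \<open>\<Omega> (dist x y) \<ge> \<Omega> \<rho>\<close>.\<close>

lemma modulus_bound_of_local:
  assumes "local_bound \<phi> A" "\<And>x. norm (\<phi> x) \<le> M" "M \<le> A" "2 * M \<le> A * \<Omega> \<rho>"
  shows "modulus_bound \<Omega> \<phi> A"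
  unfolding modulus_bound_def
proof (intro conjI allI)
  fix x y
  show "norm (\<phi> x) \<le> A" using assms(2,3) order_trans by blast
  have A: "0 \<le> A" using assms(2)[of x] assms(3) norm_ge_zero[of "\<phi> x"] by linarith
  show "norm (\<phi> x - \<phi> y) \<le> A * \<Omega> (dist x y)"
  proof (cases "dist x y < \<rho>")
    case True
    then show ?thesis using assms(1) by (simp add: local_bound_def)
  next
    case False
    have "norm (\<phi> x - \<phi> y) \<le> 2 * M"
      using norm_triangle_ineq4[of "\<phi> x" "\<phi> y"] assms(2)[of x] assms(2)[of y] by linarith
    also have "\<dots> \<le> A * \<Omega> \<rho>" by fact
    also have "\<dots> \<le> A * \<Omega> (dist x y)"
      using False const A by (intro mult_left_mono modulus_mono[OF \<Omega>(1)]) auto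
    finally show ?thesis .
  qed
qed

lemma local_bound_pow:
  assumes "\<And>x. norm (\<phi> x) \<le> M" "local_bound \<phi> A" "A \<ge> 0"
  shows "local_bound ((P ^^ n) \<phi>) (A + real n * K * M)"
  unfolding local_bound_def
proof (intro allI impI)
  fix x y :: circle assume xy: "dist x y < \<rho>"
  have "lam ^ n * dist x y \<le> dist x y" "0 \<le> lam ^ n * dist x y"
    using const by (auto intro!: mult_left_le_one_le power_le_one)
  then have "0 \<le> c ^ n * (\<Omega> (dist x y) - \<Omega> (lam ^ n * dist x y))"
    using const modulus_mono[OF \<Omega>(1)] by (intro mult_nonneg_nonneg) auto
  then have "A * (\<Omega> (dist x y) - c ^ n * (\<Omega> (dist x y) - \<Omega> (lam ^ n * dist x y))) \<le> A * \<Omega> (dist x y)"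
    using assms(3) by (intro mult_left_mono) auto
  then show "norm ((P ^^ n) \<phi> x - (P ^^ n) \<phi> y) \<le> (A + real n * K * M) * \<Omega> (dist x y)"
    using lasota_yorke_pow[OF assms(1,3) local_boundD[OF assms(2)] xy, where n = n]
    by (simp add: algebra_simps)
qed

text \<open>The supremum over \<open>d\<close> falls below 1/2 for all small \<open>x\<close>, and
  some power \<open>lam ^ N\<close> is such an \<open>x\<close>.\<close>

lemma orderly_scale:
  obtains N where "\<And>d. 0 \<le> d \<Longrightarrow> d < 1/2 \<Longrightarrow> \<Omega> (lam ^ N * d) \<le> \<Omega> d / 2"
proof -
  have "\<forall>\<^sub>F x in at_right 0. (SUP d\<in>{0<..<1/2}. \<Omega> (d * x) / \<Omega> d) < 1/2"
    using \<Omega>(2) unfolding vanishes_orderly_def by (rule order_tendstoD) simp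
  then obtain b where b: "b > 0" "\<And>x. 0 < x \<Longrightarrow> x < b \<Longrightarrow> (SUP d\<in>{0<..<1/2}. \<Omega> (d * x) / \<Omega> d) < 1/2"
    unfolding eventually_at_right_field by auto
  have "\<forall>\<^sub>F n in sequentially. lam ^ n < b"
    using b const by (intro order_tendstoD[OF LIMSEQ_power_zero]) auto
  then obtain N where N: "lam ^ N < b" by (auto simp: eventually_sequentially)
  define x where "x = lam ^ N"
  have x: "0 < x" "x \<le> 1" "x < b" using const N by (auto simp: x_def intro: power_le_one)
  have \<Omega>pos: "\<Omega> d > 0" if "d > 0" for d using \<Omega>(1) that by (simp add: modulus_of_continuity_def)
  \<comment> \<open>For \<open>x \<le> 1\<close> the quotients are at most \<open>1\<close>, so the
    real supremum really bounds each of them.\<close>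
  have bdd: "bdd_above ((\<lambda>d. \<Omega> (d * x) / \<Omega> d) ` {0<..<1/2})"
  proof (rule bdd_aboveI2)
    fix d :: real assume d: "d \<in> {0<..<1/2}"
    then have "\<Omega> (d * x) \<le> \<Omega> d" using x by (intro modulus_mono[OF \<Omega>(1)]) (auto simp: mult_left_le)
    then show "\<Omega> (d * x) / \<Omega> d \<le> 1" using \<Omega>pos[of d] d by simp
  qed
  show ?thesis
  proof (rule that[of N])
    fix d :: real assume d: "0 \<le> d" "d < 1/2"
    show "\<Omega> (lam ^ N * d) \<le> \<Omega> d / 2"
    proof (cases "d = 0")
      case True
      then show ?thesis using \<Omega>(1) by (simp add: modulus_of_continuity_def)
    next
      case False
      then have "\<Omega> (d * x) / \<Omega> d \<le> (SUP d\<in>{0<..<1/2}. \<Omega> (d * x) / \<Omega> d)"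
        using d by (intro cSUP_upper[OF _ bdd]) auto
      then have "\<Omega> (d * x) / \<Omega> d < 1/2" using b(2)[OF x(1,3)] by linarith
      then show ?thesis using \<Omega>pos[of d] d False by (simp add: x_def field_simps)
    qed
  qed
qed

lemma lasota_yorke:
  obtains N \<theta> B where "0 \<le> \<theta>" "\<theta> < 1" "B \<ge> 0"
    "\<And>(\<phi> :: circle \<Rightarrow> 'b::real_normed_vector) M A. (\<And>x. norm (\<phi> x) \<le> M) \<Longrightarrow> local_bound \<phi> A \<Longrightarrow> A \<ge> 0 \<Longrightarrow>
       local_bound ((P ^^ N) \<phi>) (\<theta> * A + B * M)"
proof -
  obtain N where N: "\<And>d. 0 \<le> d \<Longrightarrow> d < 1/2 \<Longrightarrow> \<Omega> (lam ^ N * d) \<le> \<Omega> d / 2" by (rule orderly_scale) blast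
  \<comment> \<open>The fraction \<open>c ^ N\<close> of the weight sees at most half of
    \<open>\<Omega> d\<close>, the rest at most all of it.\<close>
  define \<theta> where "\<theta> = 1 - c ^ N / 2"
  have cN: "0 < c ^ N" "c ^ N \<le> 1" using const c_le_1 by (auto intro: power_le_one)
  show ?thesis
  proof (rule that[of \<theta> "real N * K" N])
    fix \<phi> :: "circle \<Rightarrow> 'b" and M A
    assume M: "\<And>x. norm (\<phi> x) \<le> M" and A: "local_bound \<phi> A" "A \<ge> 0"
    show "local_bound ((P ^^ N) \<phi>) (\<theta> * A + real N * K * M)"
      unfolding local_bound_def
    proof (intro allI impI)
      fix x y :: circle assume xy: "dist x y < \<rho>"
      define d where "d = dist x y"
      have "\<Omega> (lam ^ N * d) \<le> \<Omega> d / 2" using xy const by (intro N) (auto simp: d_def)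
      then have "c ^ N * (\<Omega> d / 2) \<le> c ^ N * (\<Omega> d - \<Omega> (lam ^ N * d))"
        using cN by (intro mult_left_mono) auto
      then have "\<Omega> d - c ^ N * (\<Omega> d - \<Omega> (lam ^ N * d)) \<le> \<theta> * \<Omega> d"
        by (simp add: \<theta>_def algebra_simps)
      then have "A * (\<Omega> d - c ^ N * (\<Omega> d - \<Omega> (lam ^ N * d))) \<le> A * (\<theta> * \<Omega> d)"
        using A(2) by (rule mult_left_mono)
      then show "norm ((P ^^ N) \<phi> x - (P ^^ N) \<phi> y) \<le> (\<theta> * A + real N * K * M) * \<Omega> (dist x y)"
        using lasota_yorke_pow[OF M A(2) local_boundD[OF A(1)] xy, where n = N]
        by (simp add: d_def algebra_simps)
    qed
  qed (use cN const in \<open>auto simp: \<theta>_def\<close>)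
qed

text \<open>A partition of unity with mesh \<open>d\<close> reduces the uniformity over the unit ball to the
  convergence of finitely many orbits; this replaces the Arzela-Ascoli theorem.\<close>

lemma uniform_decay:
  assumes "\<epsilon> > 0"
  obtains J where "\<And>n (\<phi> :: circle \<Rightarrow> 'b::real_normed_vector) A x.
      n \<ge> J \<Longrightarrow> modulus_bound \<Omega> \<phi> A \<Longrightarrow> (\<And>x. (\<lambda>n. (P ^^ n) \<phi> x) \<longlonglongrightarrow> 0) \<Longrightarrow>
      norm ((P ^^ n) \<phi> x) \<le> \<epsilon> * A"
proof -
  obtain d where d: "d > 0" "\<And>t. 0 \<le> t \<Longrightarrow> t \<le> d \<Longrightarrow> \<Omega> t < \<epsilon> / 4"
    using modulus_small[OF \<Omega>(1), of "\<epsilon>/4"] assms by auto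
  have "\<exists>S. finite S \<and> S \<subseteq> UNIV \<and> (UNIV :: circle set) \<subseteq> (\<Union>s\<in>S. ball s d)"
    using compact_circle d(1) unfolding compact_eq_totally_bounded by blast
  then obtain S :: "circle set" where S: "finite S" "\<And>x. \<exists>s\<in>S. dist s x < d"
    by (auto simp: subset_eq)
  define b where "b s x = max 0 (d - dist s x)" for s x :: circle
  define \<psi> where "\<psi> s x = b s x / (\<Sum>t\<in>S. b t x)" for s x
  have b0: "b s x \<ge> 0" for s x by (simp add: b_def)
  have tot: "(\<Sum>t\<in>S. b t x) > 0" for x
  proof -
    obtain s where "s \<in> S" "dist s x < d" using S(2) by blast
    then show ?thesis using b0 S(1) by (intro sum_pos2[of S s]) (auto simp: b_def)
  qed
  have \<psi>0: "\<psi> s x \<ge> 0" for s x using b0 tot[of x] by (simp add: \<psi>_def)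
  have \<psi>1: "(\<Sum>s\<in>S. \<psi> s x) = 1" for x
    using tot[of x] by (simp add: \<psi>_def flip: sum_divide_distrib)
  have \<psi>near: "dist s x \<le> d" if "\<psi> s x \<noteq> 0" for s x
    using that by (auto simp: \<psi>_def b_def max_def split: if_splits)
  have cont: "continuous_on UNIV (\<psi> s)" for s
  proof -
    have "(\<Sum>t\<in>S. b t x) \<noteq> 0" for x using tot[of x] by simp
    then show ?thesis unfolding \<psi>_def b_def by (intro continuous_intros) auto
  qed
  have "\<forall>s. \<exists>w. uniform_limit UNIV (\<lambda>n. (P ^^ n) (\<psi> s)) (\<lambda>_. w) sequentially"
    using converges[OF cont] by blast
  then obtain w where w: "\<And>s. uniform_limit UNIV (\<lambda>n. (P ^^ n) (\<psi> s)) (\<lambda>_. w s) sequentially"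
    by metis
  define e where "e = \<epsilon> / (4 * (real (card S) + 1))"
  have e: "e > 0" "real (card S) * e \<le> \<epsilon> / 4" using assms by (auto simp: e_def field_simps)
  have "\<forall>\<^sub>F n in sequentially. \<forall>s\<in>S. \<forall>x. dist ((P ^^ n) (\<psi> s) x) (w s) < e"
    using uniform_limitD[OF w e(1)] S(1) by (intro eventually_ball_finite) auto
  then obtain J where J: "\<And>n s x. n \<ge> J \<Longrightarrow> s \<in> S \<Longrightarrow> \<bar>(P ^^ n) (\<psi> s) x - w s\<bar> < e"
    unfolding eventually_sequentially dist_real_def by blast
  show ?thesis
  proof (rule that[of J])
    fix n x A and \<phi> :: "circle \<Rightarrow> 'b"
    assume n: "n \<ge> J" and \<phi>: "modulus_bound \<Omega> \<phi> A" and lim: "\<And>x. (\<lambda>n. (P ^^ n) \<phi> x) \<longlonglongrightarrow> 0"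
    have A: "A \<ge> 0" using \<phi> by (rule modulus_bound_nonneg)
    define \<phi>' where "\<phi>' = (\<lambda>y. \<Sum>s\<in>S. \<psi> s y *\<^sub>R \<phi> s)"
    \<comment> \<open>The constant approached by the orbit of the interpolant
      \<open>\<phi>'\<close>. The time \<open>J\<close> depends on the finitely many
      \<open>\<psi> s\<close>, not on \<open>\<phi>\<close>.\<close>
    define v where "v = (\<Sum>s\<in>S. w s *\<^sub>R \<phi> s)"
    have "norm (\<phi> y - \<phi>' y) \<le> \<epsilon> / 4 * A" for y
    proof -
      have "\<phi> y - \<phi>' y = (\<Sum>s\<in>S. \<psi> s y *\<^sub>R (\<phi> y - \<phi> s))"
        by (simp add: \<phi>'_def scaleR_diff_right sum_subtractf \<psi>1 flip: scaleR_sum_left)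
      also have "norm \<dots> \<le> (\<Sum>s\<in>S. \<psi> s y * (A * (\<epsilon> / 4)))"
      proof (rule sum_norm_le)
        fix s assume "s \<in> S"
        have "norm (\<phi> y - \<phi> s) \<le> A * (\<epsilon> / 4)" if "\<psi> s y \<noteq> 0"
        proof -
          have "norm (\<phi> y - \<phi> s) \<le> A * \<Omega> (dist s y)"
            using \<phi> unfolding modulus_bound_def by (metis dist_commute)
          also have "\<dots> \<le> A * (\<epsilon> / 4)"
            using d(2)[of "dist s y"] \<psi>near[OF that] A by (intro mult_left_mono) auto
          finally show ?thesis .
        qed
        then show "norm (\<psi> s y *\<^sub>R (\<phi> y - \<phi> s)) \<le> \<psi> s y * (A * (\<epsilon> / 4))"
          using \<psi>0[of s y] by (cases "\<psi> s y = 0") (auto intro: mult_left_mono)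
      qed
      also have "\<dots> = \<epsilon> / 4 * A" by (simp only: \<psi>1 flip: sum_distrib_right) simp
      finally show ?thesis .
    qed
    then have near: "norm ((P ^^ k) \<phi> y - (P ^^ k) \<phi>' y) \<le> \<epsilon> / 4 * A" for k y
      using P_pow_sup[of "\<lambda>y. \<phi> y - \<phi>' y" "\<epsilon> / 4 * A" k y] by (simp add: transfer_op_pow_diff)
    have near': "norm ((P ^^ k) \<phi>' y - v) \<le> \<epsilon> / 4 * A" if "k \<ge> J" for k y
    proof -
      have "(P ^^ k) \<phi>' y - v = (\<Sum>s\<in>S. ((P ^^ k) (\<psi> s) y - w s) *\<^sub>R \<phi> s)"
        by (simp add: \<phi>'_def v_def transfer_op_pow_lincomb scaleR_diff_left sum_subtractf)
      also have "norm \<dots> \<le> (\<Sum>s\<in>S. e * A)"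
      proof (rule sum_norm_le)
        fix s assume "s \<in> S"
        then have "\<bar>(P ^^ k) (\<psi> s) y - w s\<bar> \<le> e" using J[OF that] by (simp add: less_imp_le)
        moreover have "norm (\<phi> s) \<le> A" using \<phi> by (simp add: modulus_bound_def)
        ultimately show "norm (((P ^^ k) (\<psi> s) y - w s) *\<^sub>R \<phi> s) \<le> e * A"
          using e(1) by (simp add: mult_mono)
      qed
      also have "\<dots> \<le> \<epsilon> / 4 * A" using mult_right_mono[OF e(2) A] by simp
      finally show ?thesis .
    qed
    have v: "norm ((P ^^ k) \<phi> y - v) \<le> \<epsilon> / 2 * A" if "k \<ge> J" for k y
      using norm_triangle_ineq[of "(P ^^ k) \<phi> y - (P ^^ k) \<phi>' y" "(P ^^ k) \<phi>' y - v"]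
        near[of k y] near'[OF that, of y] by simp
    \<comment> \<open>The orbit of \<open>\<phi>\<close> stays within
      \<open>\<epsilon> / 2 * A\<close> of \<open>v\<close> and tends to \<open>0\<close>, so
      \<open>v\<close> itself is that small.\<close>
    have "(\<lambda>k. norm ((P ^^ k) \<phi> x - v)) \<longlonglongrightarrow> norm (0 - v)" by (intro tendsto_intros lim)
    then have "norm (0 - v) \<le> \<epsilon> / 2 * A"
      by (rule Lim_bounded[of _ _ J]) (use v in blast)
    then show "norm ((P ^^ n) \<phi> x) \<le> \<epsilon> * A"
      using v[OF n, of x] norm_triangle_ineq[of "(P ^^ n) \<phi> x - v" v] by simp
  qed
qed

text \<open>First \<open>j\<close> steps make the sup norm small, at the price of a local constant
  \<open>Q * A\<close>; then \<open>N * k\<close> steps contract this constant while the sup term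
  stays small. Hence \<open>k\<close> is chosen after \<open>j\<close>.\<close>

lemma halving:
  obtains n where "n > 0" "\<And>(\<phi> :: circle \<Rightarrow> 'b::real_normed_vector) A.
      modulus_bound \<Omega> \<phi> A \<Longrightarrow> (\<And>x. (\<lambda>n. (P ^^ n) \<phi> x) \<longlonglongrightarrow> 0) \<Longrightarrow>
      modulus_bound \<Omega> ((P ^^ n) \<phi>) (A / 2)"
proof -
  obtain N \<theta> B where \<theta>: "0 \<le> \<theta>" "\<theta> < 1" "B \<ge> 0" and LY:
    "\<And>(\<phi> :: circle \<Rightarrow> 'b) M A. (\<And>x. norm (\<phi> x) \<le> M) \<Longrightarrow> local_bound \<phi> A \<Longrightarrow> A \<ge> 0 \<Longrightarrow>
       local_bound ((P ^^ N) \<phi>) (\<theta> * A + B * M)"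
    by (rule lasota_yorke) blast
  \<comment> \<open>The fixed point of \<open>b = \<theta> * b + B\<close>, which sums the geometric
    series arising from iteration.\<close>
  define B' where "B' = B / (1 - \<theta>)"
  have B': "B' \<ge> 0" "\<theta> * B' + B = B'" using \<theta> by (auto simp: B'_def field_simps)
  have LYk: "local_bound ((P ^^ (N * k)) \<phi>) (\<theta> ^ k * A + B' * M)"
    if M: "\<And>x. norm (\<phi> x) \<le> M" and A: "local_bound \<phi> A" "A \<ge> 0" for \<phi> :: "circle \<Rightarrow> 'b" and M A k
  proof (induction k)
    case 0
    have "0 \<le> M" using M norm_ge_zero order_trans by blast
    then show ?case using A B' by (auto intro: local_bound_mono)
  next
    case (Suc k)
    have M0: "0 \<le> M" using M norm_ge_zero order_trans by blast
    have "local_bound ((P ^^ N) ((P ^^ (N * k)) \<phi>)) (\<theta> * (\<theta> ^ k * A + B' * M) + B * M)"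
      using \<theta> A B' M0 by (intro LY Suc P_pow_sup[OF M]) auto
    moreover have "\<theta> * (\<theta> ^ k * A + B' * M) + B * M = \<theta> ^ Suc k * A + (\<theta> * B' + B) * M"
      by (simp add: algebra_simps)
    ultimately show ?case by (simp add: funpow_add B')
  qed
  have \<Omega>\<rho>: "\<Omega> \<rho> > 0" using \<Omega>(1) const by (simp add: modulus_of_continuity_def)
  \<comment> \<open>Three demands: half of the sup norm, half of the seminorm at distances beyond
    \<open>\<rho>\<close>, and a quarter of \<open>A\<close> for the sup term in the local
    bound.\<close>
  define \<epsilon> where "\<epsilon> = min (1/2) (min (1 / (4 * (B' + 1))) (\<Omega> \<rho> / 4))"
  have \<epsilon>: "\<epsilon> > 0" "\<epsilon> \<le> 1/2" "2 * \<epsilon> \<le> \<Omega> \<rho> / 2" "B' * \<epsilon> \<le> 1/4"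
  proof -
    have "B' * \<epsilon> \<le> B' * (1 / (4 * (B' + 1)))" using B' by (intro mult_left_mono) (auto simp: \<epsilon>_def)
    also have "\<dots> \<le> 1/4" using B' by (simp add: field_simps)
    finally show "B' * \<epsilon> \<le> 1/4" .
  qed (use B' \<Omega>\<rho> in \<open>auto simp: \<epsilon>_def\<close>)
  obtain J where J: "\<And>n (\<phi> :: circle \<Rightarrow> 'b) A x.
      n \<ge> J \<Longrightarrow> modulus_bound \<Omega> \<phi> A \<Longrightarrow> (\<And>x. (\<lambda>n. (P ^^ n) \<phi> x) \<longlonglongrightarrow> 0) \<Longrightarrow>
      norm ((P ^^ n) \<phi> x) \<le> \<epsilon> * A"
    using \<epsilon>(1) by (rule uniform_decay) blast
  \<comment> \<open>The successor makes the number of steps positive, so that a root of that order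
    can be taken later.\<close>
  define j where "j = Suc J"
  define Q where "Q = 1 + real j * K"
  have Q: "Q > 0" using const by (auto simp: Q_def intro: add_pos_nonneg)
  have "\<forall>\<^sub>F k in sequentially. \<theta> ^ k < 1 / (4 * Q)"
    using \<theta> Q by (intro order_tendstoD[OF LIMSEQ_power_zero]) auto
  then obtain k where "\<theta> ^ k < 1 / (4 * Q)" by (auto simp: eventually_sequentially)
  then have k: "\<theta> ^ k * Q \<le> 1/4" using Q by (simp add: field_simps)
  show ?thesis
  proof (rule that[of "N * k + j"])
    fix \<phi> :: "circle \<Rightarrow> 'b" and A
    assume \<phi>: "modulus_bound \<Omega> \<phi> A" and lim: "\<And>x. (\<lambda>n. (P ^^ n) \<phi> x) \<longlonglongrightarrow> 0"
    have A: "A \<ge> 0" using \<phi> by (rule modulus_bound_nonneg)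
    have sup: "norm ((P ^^ n) \<phi> x) \<le> \<epsilon> * A" if "n \<ge> j" for n x
      using J[OF _ \<phi> lim] that by (simp add: j_def)
    have "local_bound ((P ^^ j) \<phi>) (A + real j * K * A)"
      using \<phi> A by (intro local_bound_pow modulus_bound_local) (auto simp: modulus_bound_def)
    then have "local_bound ((P ^^ j) \<phi>) (Q * A)" by (simp add: Q_def algebra_simps)
    then have "local_bound ((P ^^ (N * k)) ((P ^^ j) \<phi>)) (\<theta> ^ k * (Q * A) + B' * (\<epsilon> * A))"
      using sup A Q by (intro LYk) auto
    moreover have "\<theta> ^ k * (Q * A) + B' * (\<epsilon> * A) \<le> A / 2"
      using mult_right_mono[OF k A] mult_right_mono[OF \<epsilon>(4) A] by (simp add: algebra_simps)
    ultimately have "local_bound ((P ^^ (N * k + j)) \<phi>) (A / 2)"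
      by (auto simp: funpow_add intro: local_bound_mono)
    then show "modulus_bound \<Omega> ((P ^^ (N * k + j)) \<phi>) (A / 2)"
    proof (rule modulus_bound_of_local)
      show "norm ((P ^^ (N * k + j)) \<phi> x) \<le> \<epsilon> * A" for x by (rule sup) simp
      show "\<epsilon> * A \<le> A / 2" using mult_right_mono[OF \<epsilon>(2) A] by simp
      show "2 * (\<epsilon> * A) \<le> A / 2 * \<Omega> \<rho>" using mult_right_mono[OF \<epsilon>(3) A] by (simp add: algebra_simps)
    qed
  qed (simp add: j_def)
qed

lemma P_modulus_bound:
  obtains B where "B \<ge> 1" "\<And>(\<phi> :: circle \<Rightarrow> 'b::real_normed_vector) A.
    modulus_bound \<Omega> \<phi> A \<Longrightarrow> modulus_bound \<Omega> (P \<phi>) (B * A)"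
proof -
  \<comment> \<open>\<open>1 + K\<close> covers close pairs after one step,
    \<open>2 / \<Omega> \<rho>\<close> the distant ones.\<close>
  define B where "B = 1 + K + 2 / \<Omega> \<rho>"
  have \<Omega>\<rho>: "\<Omega> \<rho> > 0" using \<Omega>(1) const by (simp add: modulus_of_continuity_def)
  show ?thesis
  proof (rule that[of B])
    show "B \<ge> 1" using \<Omega>\<rho> const by (simp add: B_def)
    fix \<phi> :: "circle \<Rightarrow> 'b" and A assume \<phi>: "modulus_bound \<Omega> \<phi> A"
    have A: "A \<ge> 0" using \<phi> by (rule modulus_bound_nonneg)
    have BA: "B * A = A + K * A + 2 * A / \<Omega> \<rho>" by (simp add: B_def algebra_simps)
    have "local_bound ((P ^^ 1) \<phi>) (A + real 1 * K * A)"
      using \<phi> A by (intro local_bound_pow modulus_bound_local) (auto simp: modulus_bound_def)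
    then have "local_bound (P \<phi>) (B * A)"
      using A \<Omega>\<rho> by (auto simp: BA intro: local_bound_mono)
    then show "modulus_bound \<Omega> (P \<phi>) (B * A)"
    proof (rule modulus_bound_of_local)
      show "norm (P \<phi> x) \<le> A" for x using \<phi> by (intro P_sup) (auto simp: modulus_bound_def)
      show "A \<le> B * A" using A \<Omega>\<rho> const by (simp add: BA)
      have "2 * A / \<Omega> \<rho> \<le> B * A" using A \<Omega>\<rho> const by (simp add: BA)
      then show "2 * A \<le> B * A * \<Omega> \<rho>" using \<Omega>\<rho> by (simp add: divide_le_eq)
    qed
  qed
qed

text \<open>\<open>halving\<close> can be repeated because every \<open>P ^^ k\<close> of the
  function again has orbit limit \<open>0\<close>. \<open>B ^ m\<close> pays for the
  \<open>n mod m\<close> remaining steps, and \<open>2\<close> for rounding \<open>n\<close> down to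
  a multiple of \<open>m\<close>, as \<open>r ^ m = 1/2\<close>.\<close>

lemma exponential_decay:
  obtains D r where "D \<ge> 0" "0 < r" "r < 1" "\<And>(\<phi> :: circle \<Rightarrow> 'b::real_normed_vector) A n.
      modulus_bound \<Omega> \<phi> A \<Longrightarrow> (\<And>x. (\<lambda>n. (P ^^ n) \<phi> x) \<longlonglongrightarrow> 0) \<Longrightarrow>
      modulus_bound \<Omega> ((P ^^ n) \<phi>) (D * r ^ n * A)"
proof -
  obtain m where m: "m > 0" and half: "\<And>(\<phi> :: circle \<Rightarrow> 'b) A.
      modulus_bound \<Omega> \<phi> A \<Longrightarrow> (\<And>x. (\<lambda>n. (P ^^ n) \<phi> x) \<longlonglongrightarrow> 0) \<Longrightarrow>
      modulus_bound \<Omega> ((P ^^ m) \<phi>) (A / 2)"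
    by (rule halving) blast
  obtain B where B: "B \<ge> 1" "\<And>(\<phi> :: circle \<Rightarrow> 'b) A.
    modulus_bound \<Omega> \<phi> A \<Longrightarrow> modulus_bound \<Omega> (P \<phi>) (B * A)"
    by (rule P_modulus_bound) blast
  define r where "r = root m (1/2)"
  have r: "0 < r" "r < 1" "r ^ m = 1/2"
    using m by (auto simp: r_def real_root_gt_zero real_root_pow_pos2)
  show ?thesis
  proof (rule that[of "2 * B ^ m" r])
    fix \<phi> :: "circle \<Rightarrow> 'b" and A n
    assume \<phi>: "modulus_bound \<Omega> \<phi> A" and lim: "\<And>x. (\<lambda>n. (P ^^ n) \<phi> x) \<longlonglongrightarrow> 0"
    have A: "A \<ge> 0" using \<phi> by (rule modulus_bound_nonneg)
    have q: "modulus_bound \<Omega> ((P ^^ (m * q)) \<phi>) ((1/2) ^ q * A)" for q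
    proof (induction q)
      case (Suc q)
      have "(\<lambda>n. (P ^^ n) ((P ^^ (m * q)) \<phi>) x) \<longlonglongrightarrow> 0" for x
        using LIMSEQ_ignore_initial_segment[OF lim, of "m * q" x] by (simp add: funpow_add)
      from half[OF Suc this] show ?case by (simp add: funpow_add)
    qed (use \<phi> in simp)
    have i: "modulus_bound \<Omega> ((P ^^ i) \<psi>) (B ^ i * A')" if "modulus_bound \<Omega> \<psi> A'"
      for i A' and \<psi> :: "circle \<Rightarrow> 'b"
    proof (induction i)
      case (Suc i)
      then show ?case using B(2)[OF Suc] by (simp add: ac_simps)
    qed (use that in simp)
    have n: "n = n mod m + m * (n div m)" by simp
    have "(1/2 :: real) ^ (n div m) * r ^ m \<le> r ^ n"
    proof -
      have "(1/2 :: real) ^ (n div m) * r ^ m = r ^ (m * (n div m) + m)"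
        by (simp add: power_add power_mult r(3))
      also have "\<dots> \<le> r ^ n" using r m mod_less_divisor[of m n] n
        by (intro power_decreasing) linarith+
      finally show ?thesis .
    qed
    then have le: "(1/2 :: real) ^ (n div m) \<le> 2 * r ^ n" using r(3) by simp
    have "modulus_bound \<Omega> ((P ^^ n) \<phi>) (B ^ (n mod m) * ((1/2) ^ (n div m) * A))"
      using i[OF q, of "n mod m" "n div m"] by (simp flip: funpow_add comp_apply[of "P ^^ _" "P ^^ _"])
    moreover have "B ^ (n mod m) * ((1/2) ^ (n div m) * A) \<le> B ^ m * (2 * r ^ n * A)"
      using B(1) A le m r by (intro mult_mono power_increasing) (auto intro: less_imp_le)
    ultimately show "modulus_bound \<Omega> ((P ^^ n) \<phi>) (2 * B ^ m * r ^ n * A)"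
      by (auto simp: ac_simps intro: modulus_bound_mono[OF _ _ \<Omega>(1)])
  qed (use B r in auto)
qed

end

section \<open>The resolvent\<close>

lemma modulus_bound_cmult:
  fixes \<phi> :: "circle \<Rightarrow> 'b::real_normed_field"
  assumes "modulus_bound W \<phi> A"
  shows "modulus_bound W (\<lambda>x. c * \<phi> x) (norm c * A)"
  unfolding modulus_bound_def
proof (intro conjI allI)
  fix x y
  show "norm (c * \<phi> x) \<le> norm c * A"
    using assms by (simp add: modulus_bound_def norm_mult mult_left_mono)
  have "norm (c * \<phi> x - c * \<phi> y) = norm c * norm (\<phi> x - \<phi> y)"
    by (simp add: norm_mult flip: right_diff_distrib)
  also have "\<dots> \<le> norm c * (A * W (dist x y))"
    using assms by (intro mult_left_mono) (simp_all add: modulus_bound_def)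
  finally show "norm (c * \<phi> x - c * \<phi> y) \<le> norm c * A * W (dist x y)" by simp
qed

lemma transfer_op_suminf:
  fixes \<phi> :: "nat \<Rightarrow> circle \<Rightarrow> 'b::real_normed_vector"
  assumes "\<And>y. summable (\<lambda>k. \<phi> k y)"
  shows "transfer_op T f (\<lambda>y. \<Sum>k. \<phi> k y) x = (\<Sum>k. transfer_op T f (\<phi> k) x)"
  unfolding transfer_op_def
  by (subst suminf_sum) (simp_all add: assms summable_scaleR_right suminf_scaleR_right)

context normalised_transfer
begin

lemma P_pow_Re: "(P ^^ n) (\<lambda>y. Re (\<phi> y)) = (\<lambda>x. Re ((P ^^ n) \<phi> x))"
proof (induction n)
  case (Suc n)
  then show ?case by (simp add: transfer_op_def)
qed simp

lemma P_pow_Im: "(P ^^ n) (\<lambda>y. Im (\<phi> y)) = (\<lambda>x. Im ((P ^^ n) \<phi> x))"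
proof (induction n)
  case (Suc n)
  then show ?case by (simp add: transfer_op_def)
qed simp

lemma converges_complex:
  fixes \<phi> :: "circle \<Rightarrow> complex"
  assumes "continuous_on UNIV \<phi>"
  obtains w where "\<And>x. (\<lambda>n. (P ^^ n) \<phi> x) \<longlonglongrightarrow> w"
proof -
  obtain a where a: "uniform_limit UNIV (\<lambda>n. (P ^^ n) (\<lambda>y. Re (\<phi> y))) (\<lambda>_. a) sequentially"
    using converges[of "\<lambda>y. Re (\<phi> y)"] assms by (auto intro: continuous_intros)
  obtain b where b: "uniform_limit UNIV (\<lambda>n. (P ^^ n) (\<lambda>y. Im (\<phi> y))) (\<lambda>_. b) sequentially"
    using converges[of "\<lambda>y. Im (\<phi> y)"] assms by (auto intro: continuous_intros)
  have "(\<lambda>n. (P ^^ n) \<phi> x) \<longlonglongrightarrow> Complex a b" for x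
    using tendsto_uniform_limitI[OF a, of x] tendsto_uniform_limitI[OF b, of x]
    by (simp add: P_pow_Re P_pow_Im tendsto_complex_iff)
  then show ?thesis by (rule that)
qed

text \<open>Each function is its limit constant plus a function with orbit limit \<open>0\<close>.
  On constants \<open>z - P\<close> is multiplication by \<open>z - 1\<close>; on the rest the
  Neumann series converges for \<open>r < cmod z\<close>.\<close>

lemma resolvent:
  obtains r where "0 < r" "r < 1"
    "\<And>z (\<phi> :: circle \<Rightarrow> complex) A. r < cmod z \<Longrightarrow> z \<noteq> 1 \<Longrightarrow> modulus_bound \<Omega> \<phi> A \<Longrightarrow>
       (\<And>x. z * \<phi> x = P \<phi> x) \<Longrightarrow> \<phi> = (\<lambda>_. 0)"
    "\<And>z. r < cmod z \<Longrightarrow> z \<noteq> 1 \<Longrightarrow> \<exists>R. \<forall>(\<psi> :: circle \<Rightarrow> complex) A. modulus_bound \<Omega> \<psi> A \<longrightarrow>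
       (\<exists>\<phi>. modulus_bound \<Omega> \<phi> (R * A) \<and> (\<forall>x. z * \<phi> x - P \<phi> x = \<psi> x))"
proof -
  obtain D r where r: "D \<ge> 0" "0 < r" "r < 1" and decay: "\<And>(\<phi> :: circle \<Rightarrow> complex) A n.
      modulus_bound \<Omega> \<phi> A \<Longrightarrow> (\<And>x. (\<lambda>n. (P ^^ n) \<phi> x) \<longlonglongrightarrow> 0) \<Longrightarrow>
      modulus_bound \<Omega> ((P ^^ n) \<phi>) (D * r ^ n * A)"
    by (rule exponential_decay) blast
  show ?thesis
  proof (rule that[of r])
    fix z A and \<phi> :: "circle \<Rightarrow> complex"
    assume z: "r < cmod z" "z \<noteq> 1" and \<phi>: "modulus_bound \<Omega> \<phi> A"
      and eq: "\<And>x. z * \<phi> x = P \<phi> x"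
    have P\<phi>: "P \<phi> = (\<lambda>x. z * \<phi> x)" using eq by simp
    have pow: "(P ^^ n) \<phi> = (\<lambda>x. z ^ n * \<phi> x)" for n
    proof (induction n)
      case (Suc n)
      then show ?case by (simp add: transfer_op_cmult P\<phi> mult.assoc mult.left_commute)
    qed simp
    obtain w where w: "\<And>x. (\<lambda>n. (P ^^ n) \<phi> x) \<longlonglongrightarrow> w"
      using converges_complex modulus_bound_continuous[OF \<phi> \<Omega>(1)] by blast
    \<comment> \<open>The orbit is \<open>z ^ n * \<phi>\<close>; shifting it by one step gives
      \<open>z * w = w\<close>.\<close>
    have "w = 0"
    proof -
      have "(\<lambda>n. z * (z ^ n * \<phi> undefined)) \<longlonglongrightarrow> z * w"
        using w[of undefined] by (intro tendsto_intros) (simp add: pow)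
      moreover have "(\<lambda>n. z * (z ^ n * \<phi> undefined)) \<longlonglongrightarrow> w"
        using LIMSEQ_Suc[OF w[of undefined]] by (simp only: pow power_Suc mult.assoc)
      ultimately have "z * w = w" by (rule LIMSEQ_unique)
      then show "w = 0" using z(2) by simp
    qed
    then have bd: "modulus_bound \<Omega> ((P ^^ n) \<phi>) (D * r ^ n * A)" for n
      using decay[OF \<phi>] w by simp
    have z0: "cmod z > 0" using z r by linarith
    have "\<phi> x = 0" for x
    proof -
      have "cmod (\<phi> x) \<le> D * A * (r / cmod z) ^ n" for n
      proof -
        have "cmod z ^ n * cmod (\<phi> x) \<le> D * r ^ n * A"
          using bd[of n] by (simp add: modulus_bound_def pow norm_mult norm_power)
        then show ?thesis using z0 by (simp add: power_divide field_simps)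
      qed
      moreover have "(\<lambda>n. D * A * (r / cmod z) ^ n) \<longlonglongrightarrow> D * A * 0"
        using z z0 r by (intro tendsto_intros LIMSEQ_power_zero) simp
      ultimately have "cmod (\<phi> x) \<le> D * A * 0"
        by (intro LIMSEQ_le_const[of _ "D * A * 0"]) auto
      then show ?thesis by simp
    qed
    then show "\<phi> = (\<lambda>_. 0)" by blast
  next
    fix z assume z: "r < cmod z" "z \<noteq> 1"
    have z0: "cmod z > 0" using z r by linarith
    then have zn: "z \<noteq> 0" by auto
    define b where "b k = 2 * D / cmod z * (r / cmod z) ^ k" for k
    have b: "summable b" unfolding b_def using z z0 r by (intro summable_mult summable_geometric) simp
    \<comment> \<open>The first term inverts \<open>z - 1\<close> on the constant part; the
      \<open>2\<close> inside \<open>b\<close> comes from the bound \<open>2 * A\<close> on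
      \<open>\<psi>0\<close>.\<close>
    define R where "R = 1 / cmod (z - 1) + suminf b"
    have "\<exists>\<phi>. modulus_bound \<Omega> \<phi> (R * A) \<and> (\<forall>x. z * \<phi> x - P \<phi> x = \<psi> x)"
      if \<psi>: "modulus_bound \<Omega> \<psi> A" for \<psi> :: "circle \<Rightarrow> complex" and A
    proof -
      obtain w where w: "\<And>x. (\<lambda>n. (P ^^ n) \<psi> x) \<longlonglongrightarrow> w"
        using converges_complex modulus_bound_continuous[OF \<psi> \<Omega>(1)] by blast
      have "(\<lambda>n. norm ((P ^^ n) \<psi> undefined)) \<longlonglongrightarrow> cmod w" by (intro tendsto_intros w)
      moreover have "norm ((P ^^ n) \<psi> undefined) \<le> A" for n
        using \<psi> by (intro P_pow_sup) (simp add: modulus_bound_def)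
      ultimately have wA: "cmod w \<le> A" by (intro Lim_bounded[of _ _ 0]) auto
      define \<psi>0 where "\<psi>0 = (\<lambda>x. \<psi> x - w)"
      have "modulus_bound \<Omega> (\<lambda>x. \<psi> x + (- w)) (A + norm (- w))"
        by (intro modulus_bound_add \<psi> modulus_bound_const \<Omega>)
      then have \<psi>0: "modulus_bound \<Omega> \<psi>0 (2 * A)"
        using wA by (auto simp: \<psi>0_def intro: modulus_bound_mono[OF _ _ \<Omega>(1)])
      have "(\<lambda>n. (P ^^ n) \<psi>0 x) \<longlonglongrightarrow> 0" for x
        unfolding \<psi>0_def transfer_op_pow_diff P_pow_const
        using tendsto_diff[OF w[of x] tendsto_const[of w]] by simp
      then have dec: "modulus_bound \<Omega> ((P ^^ k) \<psi>0) (D * r ^ k * (2 * A))" for k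
        by (rule decay[OF \<psi>0])
      define \<phi> where "\<phi> k = (\<lambda>x. 1 / z ^ Suc k * (P ^^ k) \<psi>0 x)" for k
      have \<phi>: "modulus_bound \<Omega> (\<phi> k) (b k * A)" for k
      proof -
        have eq: "norm (1 / z ^ Suc k) * (D * r ^ k * (2 * A)) = b k * A"
          by (simp add: b_def norm_divide norm_mult norm_power power_divide)
        show ?thesis
          using modulus_bound_cmult[OF dec[of k], of "1 / z ^ Suc k"] unfolding \<phi>_def eq .
      qed
      define \<Phi> where "\<Phi> = (\<lambda>x. \<Sum>k. \<phi> k x)"
      have s: "summable (\<lambda>k. \<phi> k x)" for x
        using modulus_bound_suminf(1)[OF \<phi> summable_mult2[OF b]] .
      have \<Phi>: "modulus_bound \<Omega> \<Phi> (suminf b * A)"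
        using modulus_bound_suminf(2)[OF \<phi> summable_mult2[OF b]] suminf_mult2[OF b, of A]
        by (simp add: \<Phi>_def)
      have P\<phi>: "P (\<phi> k) x = z * \<phi> (Suc k) x" for k x
        unfolding \<phi>_def transfer_op_cmult using zn by simp
      \<comment> \<open>\<open>P\<close> shifts the terms of the series, so \<open>P \<Phi>\<close>
        is \<open>z * \<Phi>\<close> without its first term
        \<open>z * \<phi> 0 = \<psi>0\<close>.\<close>
      have P\<Phi>: "P \<Phi> x = z * \<Phi> x - \<psi>0 x" for x
      proof -
        have "P \<Phi> x = (\<Sum>k. z * \<phi> (Suc k) x)"
          unfolding \<Phi>_def by (simp add: transfer_op_suminf[OF s] P\<phi>)
        also have "\<dots> = z * (\<Phi> x - \<phi> 0 x)"
          using suminf_mult[of "\<lambda>k. \<phi> (Suc k) x" z] suminf_split_head[OF s[of x]] s[of x]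
          by (simp add: \<Phi>_def summable_Suc_iff[of "\<lambda>k. \<phi> k x"])
        also have "\<dots> = z * \<Phi> x - \<psi>0 x" using zn by (simp add: \<phi>_def right_diff_distrib)
        finally show ?thesis .
      qed
      define v where "v = w / (z - 1)"
      have v: "z * v - v = w" proof -
        have "v * (z - 1) = w" using z(2) by (simp add: v_def)
        then show ?thesis by (simp add: algebra_simps)
      qed
      show ?thesis
      proof (intro exI[of _ "\<lambda>x. v + \<Phi> x"] conjI allI)
        have "modulus_bound \<Omega> (\<lambda>x. v + \<Phi> x) (norm v + suminf b * A)"
          by (intro modulus_bound_add modulus_bound_const \<Omega> \<Phi>)
        moreover have "norm v \<le> 1 / cmod (z - 1) * A"
          using wA by (simp add: v_def norm_divide divide_right_mono)
        ultimately show "modulus_bound \<Omega> (\<lambda>x. v + \<Phi> x) (R * A)"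
          by (auto simp: R_def distrib_right intro: modulus_bound_mono[OF _ _ \<Omega>(1)])
        show "z * (v + \<Phi> x) - P (\<lambda>x. v + \<Phi> x) x = \<psi> x" for x
          using v by (simp add: transfer_op_add P_const P\<Phi> \<psi>0_def algebra_simps)
      qed
    qed
    then show "\<exists>R. \<forall>\<psi> A. modulus_bound \<Omega> \<psi> A \<longrightarrow>
       (\<exists>\<phi>. modulus_bound \<Omega> \<phi> (R * A) \<and> (\<forall>x. z * \<phi> x - P \<phi> x = \<psi> x))" by blast
  qed (use r in auto)
qed

end

section \<open>Normalisation by the eigenfunction\<close>

text \<open>The potential cohomologous to \<open>f - ln chi\<close> through \<open>ln h\<close>.
  Since \<open>h (T y)\<close> is constant on each fibre, it factors out of the transfer
  sum.\<close>

definition normalised_potential ::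
    "(circle \<Rightarrow> circle) \<Rightarrow> (circle \<Rightarrow> real) \<Rightarrow> real \<Rightarrow> (circle \<Rightarrow> real) \<Rightarrow> circle \<Rightarrow> real" where
  "normalised_potential T f chi h y = f y + ln (h y) - ln (h (T y)) - ln chi"

lemma transfer_op_normalised:
  fixes \<phi> :: "circle \<Rightarrow> 'b::real_vector"
  assumes "chi > 0" "\<And>x. h x > 0"
  shows "transfer_op T f (\<lambda>y. h y *\<^sub>R \<phi> y) x
    = (chi * h x) *\<^sub>R transfer_op T (normalised_potential T f chi h) \<phi> x"
proof -
  have "exp (f y) * h y = chi * h x * exp (normalised_potential T f chi h y)" if "T y = x" for y
  proof -
    have "exp (normalised_potential T f chi h y) = exp (f y) * h y / h x / chi"
      using assms that by (simp add: normalised_potential_def exp_add exp_diff)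
    then show ?thesis using assms(1) assms(2)[of x] by simp
  qed
  then show ?thesis
    unfolding transfer_op_def scaleR_sum_right by (intro sum.cong) auto
qed

lemma transfer_op_pow_normalised:
  fixes \<phi> :: "circle \<Rightarrow> 'b::real_vector"
  assumes "chi > 0" "\<And>x. h x > 0"
  shows "(transfer_op T f ^^ n) (\<lambda>y. h y *\<^sub>R \<phi> y)
    = (\<lambda>x. h x *\<^sub>R (chi ^ n *\<^sub>R (transfer_op T (normalised_potential T f chi h) ^^ n) \<phi> x))"
proof (induction n)
  case (Suc n)
  have step: "transfer_op T f (\<lambda>y. h y *\<^sub>R (a *\<^sub>R \<psi> y))
    = (\<lambda>x. h x *\<^sub>R ((chi * a) *\<^sub>R transfer_op T (normalised_potential T f chi h) \<psi> x))" for a \<psi>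
  proof
    fix x
    have "transfer_op T f (\<lambda>y. h y *\<^sub>R (a *\<^sub>R \<psi> y)) x
        = (chi * h x) *\<^sub>R transfer_op T (normalised_potential T f chi h) (\<lambda>y. a *\<^sub>R \<psi> y) x"
      by (rule transfer_op_normalised[OF assms])
    moreover have "transfer_op T g (\<lambda>y. a *\<^sub>R \<psi> y) x = a *\<^sub>R transfer_op T g \<psi> x" for g
      by (simp add: transfer_op_def scaleR_sum_right ac_simps)
    ultimately show "transfer_op T f (\<lambda>y. h y *\<^sub>R (a *\<^sub>R \<psi> y)) x
        = h x *\<^sub>R ((chi * a) *\<^sub>R transfer_op T (normalised_potential T f chi h) \<psi> x)"
      by (simp only: scaleR_scaleR ac_simps)
  qed
  show ?case by (simp only: funpow.simps comp_apply Suc step power_Suc)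
qed simp

lemma abs_exp_minus_one_le: "\<bar>exp t - 1\<bar> \<le> \<bar>t\<bar> * exp \<bar>t\<bar>" for t :: real
proof (cases "t \<ge> 0")
  case True
  have "exp t * (1 - t) \<le> exp t * exp (- t)"
    using exp_ge_add_one_self[of "- t"] by (intro mult_left_mono) auto
  then show ?thesis using True by (simp add: exp_minus algebra_simps)
next
  case False
  then have "exp t < 1" by simp
  then have "\<bar>exp t - 1\<bar> \<le> \<bar>t\<bar> * 1" using False exp_ge_add_one_self[of t] by linarith
  also have "\<dots> \<le> \<bar>t\<bar> * exp \<bar>t\<bar>" by (intro mult_left_mono) auto
  finally show ?thesis .
qed

lemma abs_ln_diff_le:
  assumes "0 < m" "m \<le> a" "m \<le> b"
  shows "\<bar>ln a - ln b\<bar> \<le> \<bar>a - b\<bar> / (m :: real)"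
proof -
  have *: "ln x - ln y \<le> \<bar>a - b\<bar> / m" if "m \<le> x" "m \<le> y" "\<bar>x - y\<bar> = \<bar>a - b\<bar>" for x y
  proof -
    have "ln x - ln y \<le> (x - y) / y" using that assms by (intro ln_diff_le) auto
    also have "\<dots> \<le> \<bar>a - b\<bar> / m" using that assms by (intro frac_le) auto
    finally show ?thesis .
  qed
  show ?thesis using *[of a b] *[of b a] assms by (simp add: abs_le_iff abs_minus_commute)
qed

text \<open>Logarithms turn the regularity of \<open>f\<close> and \<open>h\<close> into an additive
  estimate on the potential; exponentiating on a bounded range gives the relative
  distortion.\<close>

lemma RPF_normalised_transfer:
  assumes V: "admissible V" and \<omega>: "modulus_of_continuity \<omega>" and \<Omega>: "modulus_of_continuity \<Omega>"
    and compat: "compatible (circle_map V) \<Omega> \<omega>" and orderly: "vanishes_orderly \<Omega>"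
    and f: "f \<in> modulus_space \<omega>" and rpf: "RPF_triple (circle_map V) \<Omega> f chi h \<nu>"
  obtains \<rho> lam c K where
    "normalised_transfer (circle_map V) (normalised_potential (circle_map V) f chi h) \<Omega> \<rho> lam c K"
proof -
  let ?T = "circle_map V" and ?F = "normalised_potential (circle_map V) f chi h"
  have chi: "chi > 0" and hpos: "\<And>x. h x > 0" and h: "h \<in> modulus_space \<Omega>"
    and eig: "\<And>x. transfer_op ?T f h x = chi * h x"
    using rpf by (auto simp: RPF_triple_def)
  have hcont: "continuous_on UNIV h" using h by (simp add: modulus_space_def)
  obtain H where H: "modulus_bound \<Omega> h H" using modulus_space_bound[OF h \<Omega>] by blast
  obtain M where M: "modulus_bound \<omega> f M" using modulus_space_bound[OF f \<omega>] by blast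
  have M0: "M \<ge> 0" using M by (rule modulus_bound_nonneg)
  have H0: "H \<ge> 0" using H by (rule modulus_bound_nonneg)
  obtain x0 where x0: "\<And>x. h x0 \<le> h x"
    using continuous_attains_inf[OF compact_circle _ hcont] by auto
  define m where "m = h x0"
  have m: "m > 0" "\<And>x. m \<le> h x" using hpos x0 by (auto simp: m_def)
  have hH: "h x \<le> H" for x using H by (auto simp: modulus_bound_def abs_le_iff)
  have lnh: "\<bar>ln (h a) - ln (h b)\<bar> \<le> H / m * \<Omega> (dist a b)" for a b
  proof -
    have "\<bar>ln (h a) - ln (h b)\<bar> \<le> \<bar>h a - h b\<bar> / m" using m by (intro abs_ln_diff_le) auto
    also have "\<dots> \<le> H * \<Omega> (dist a b) / m"
      using H m by (intro divide_right_mono) (auto simp: modulus_bound_def)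
    finally show ?thesis by simp
  qed
  obtain \<rho>1 C where \<rho>1: "\<rho>1 > 0" "C > 0" and pair:
    "\<And>x y. dist x y < \<rho>1 \<Longrightarrow> \<exists>\<tau>. bij_betw \<tau> (?T -` {x}) (?T -` {y}) \<and>
       (\<forall>u\<in>?T -` {x}. dist u (\<tau> u) \<le> dist x y \<and> C * \<omega> (dist u (\<tau> u)) \<le> \<Omega> (dist x y))"
    by (rule compatible_pairing[OF V compat \<Omega>]) blast
  obtain \<rho>2 lam where \<rho>2: "\<rho>2 > 0" "0 < lam" "lam < 1" and expand:
    "\<And>x. \<exists>a\<in>?T -` {x}. \<forall>b. dist a b < \<rho>2 \<longrightarrow> dist a b \<le> lam * dist x (?T b)"
    by (rule expanding_preimage[OF V]) blast
  define \<rho> where "\<rho> = min (1/2) (min \<rho>1 \<rho>2)"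
  define c where "c = exp (- M + ln m - ln H - ln chi)"
  \<comment> \<open>\<open>M / C\<close> is the variation of \<open>f\<close> through compatibility;
    \<open>H / m\<close> occurs for \<open>ln h\<close> at the preimages and again at the base
    points.\<close>
  define K1 where "K1 = M / C + 2 * (H / m)"
  \<comment> \<open>The exponential factor linearises \<open>exp\<close>; no circle distance exceeds
    1/2.\<close>
  define K where "K = K1 * exp (K1 * \<Omega> (1/2))"
  have K1: "K1 \<ge> 0" using M0 H0 \<rho>1 m by (simp add: K1_def)
  have "normalised_transfer ?T ?F \<Omega> \<rho> lam c K"
  proof
    show "finite (?T -` {x})" for x by (rule finite_circle_map_vimage[OF V])
    show "c \<le> exp (?F x)" for x
    proof -
      have "\<bar>f x\<bar> \<le> M" using M by (simp add: modulus_bound_def)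
      then have "- M \<le> f x" by linarith
      moreover have "ln m \<le> ln (h x)" "ln (h (?T x)) \<le> ln H"
        using m hH hpos by (auto intro!: ln_mono less_le_trans[OF hpos])
      ultimately show ?thesis by (simp add: c_def normalised_potential_def)
    qed
    show "(\<Sum>u\<in>?T -` {x}. exp (?F u)) = 1" for x
      using transfer_op_normalised[OF chi hpos, where T = ?T and f = f and \<phi> = "\<lambda>_. 1::real" and x = x] eig[of x] chi hpos[of x]
      by (simp add: transfer_op_def)
    show "\<exists>\<tau>. bij_betw \<tau> (?T -` {x}) (?T -` {y}) \<and>
       (\<forall>u\<in>?T -` {x}. dist u (\<tau> u) \<le> dist x y \<and>
          \<bar>exp (?F u) - exp (?F (\<tau> u))\<bar> \<le> K * \<Omega> (dist x y) * exp (?F (\<tau> u))) \<and>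
       (\<exists>u\<in>?T -` {x}. dist u (\<tau> u) \<le> lam * dist x y)" if xy: "dist x y < \<rho>" for x y
    proof -
      define d where "d = dist x y"
      obtain \<tau> where \<tau>: "bij_betw \<tau> (?T -` {x}) (?T -` {y})"
        and \<tau>d: "\<And>u. u \<in> ?T -` {x} \<Longrightarrow> dist u (\<tau> u) \<le> d"
        and \<tau>\<omega>: "\<And>u. u \<in> ?T -` {x} \<Longrightarrow> C * \<omega> (dist u (\<tau> u)) \<le> \<Omega> d"
        using pair[of x y] xy by (auto simp: \<rho>_def d_def)
      have \<tau>T: "?T (\<tau> u) = y" if "u \<in> ?T -` {x}" for u
        using \<tau> that by (auto simp: bij_betw_def)
      have \<Omega>d: "0 \<le> \<Omega> d" "\<Omega> d \<le> \<Omega> (1/2)"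
        using dist_circle_le_half[of x y] modulus_nonneg[OF \<Omega>] modulus_mono[OF \<Omega>] by (auto simp: d_def)
      have "\<bar>exp (?F u) - exp (?F (\<tau> u))\<bar> \<le> K * \<Omega> d * exp (?F (\<tau> u))" if u: "u \<in> ?T -` {x}" for u
      proof -
        define t where "t = ?F u - ?F (\<tau> u)"
        have "\<bar>f u - f (\<tau> u)\<bar> \<le> M * \<omega> (dist u (\<tau> u))" using M by (simp add: modulus_bound_def)
        also have "\<dots> \<le> M * (\<Omega> d / C)"
          using \<tau>\<omega>[OF u] \<rho>1 M0 by (intro mult_left_mono) (auto simp: field_simps)
        finally have 1: "\<bar>f u - f (\<tau> u)\<bar> \<le> M / C * \<Omega> d" by simp
        have "H / m * \<Omega> (dist u (\<tau> u)) \<le> H / m * \<Omega> d"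
          using \<tau>d[OF u] H0 m by (intro mult_left_mono modulus_mono[OF \<Omega>]) auto
        then have 2: "\<bar>ln (h u) - ln (h (\<tau> u))\<bar> \<le> H / m * \<Omega> d" using lnh[of u "\<tau> u"] by linarith
        have 3: "\<bar>ln (h x) - ln (h y)\<bar> \<le> H / m * \<Omega> d" using lnh[of x y] by (simp add: d_def)
        have "t = (f u - f (\<tau> u)) + (ln (h u) - ln (h (\<tau> u))) - (ln (h x) - ln (h y))"
          using u \<tau>T[OF u] by (simp add: t_def normalised_potential_def)
        then have "\<bar>t\<bar> \<le> M / C * \<Omega> d + H / m * \<Omega> d + H / m * \<Omega> d" using 1 2 3 by linarith
        then have t: "\<bar>t\<bar> \<le> K1 * \<Omega> d" by (simp add: K1_def algebra_simps)
        also have "\<dots> \<le> K1 * \<Omega> (1/2)" using \<Omega>d K1 by (intro mult_left_mono)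
        finally have t': "exp \<bar>t\<bar> \<le> exp (K1 * \<Omega> (1/2))" by simp
        have "\<bar>exp t - 1\<bar> \<le> \<bar>t\<bar> * exp \<bar>t\<bar>" by (rule abs_exp_minus_one_le)
        also have "\<dots> \<le> K1 * \<Omega> d * exp (K1 * \<Omega> (1/2))" using t t' K1 \<Omega>d by (intro mult_mono) auto
        finally have "\<bar>exp t - 1\<bar> * exp (?F (\<tau> u)) \<le> K * \<Omega> d * exp (?F (\<tau> u))"
          by (simp add: K_def ac_simps)
        moreover have "exp (?F u) - exp (?F (\<tau> u)) = (exp t - 1) * exp (?F (\<tau> u))"
          by (simp add: t_def left_diff_distrib flip: exp_add)
        ultimately show ?thesis by (simp add: abs_mult)
      qed
      moreover have "\<exists>u\<in>?T -` {x}. dist u (\<tau> u) \<le> lam * d"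
      proof -
        obtain u where u: "u \<in> ?T -` {x}" "\<And>b. dist u b < \<rho>2 \<Longrightarrow> dist u b \<le> lam * dist x (?T b)"
          using expand by blast
        have "dist u (\<tau> u) < \<rho>2" using \<tau>d[OF u(1)] xy by (simp add: d_def \<rho>_def)
        then show ?thesis using u \<tau>T[OF u(1)] by (auto simp: d_def)
      qed
      ultimately show ?thesis using \<tau> \<tau>d unfolding d_def by blast
    qed
    show "\<exists>w. uniform_limit UNIV (\<lambda>n. (transfer_op ?T ?F ^^ n) \<psi>) (\<lambda>_. w::real) sequentially"
      if \<psi>: "continuous_on UNIV \<psi>" for \<psi> :: "circle \<Rightarrow> real"
    proof -
      define w where "w = (\<integral>y. h y * \<psi> y \<partial>\<nu>)"
      have "continuous_on UNIV (\<lambda>y. h y * \<psi> y)" using hcont \<psi> by (intro continuous_intros)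
      then have lim: "uniform_limit UNIV (\<lambda>n x. ((transfer_op ?T f ^^ n) (\<lambda>y. h y * \<psi> y)) x / chi ^ n)
          (\<lambda>x. h x * w) sequentially"
        using rpf unfolding RPF_triple_def w_def by blast
      have eq: "((transfer_op ?T f ^^ n) (\<lambda>y. h y * \<psi> y)) x / chi ^ n = h x * (transfer_op ?T ?F ^^ n) \<psi> x" for n x
        using transfer_op_pow_normalised[OF chi hpos, where T = ?T and f = f and n = n and \<phi> = \<psi>] chi by simp
      \<comment> \<open>Dividing the known limit by \<open>h\<close> preserves uniformity since
        \<open>h \<ge> m > 0\<close>.\<close>
      have "uniform_limit UNIV (\<lambda>n. (transfer_op ?T ?F ^^ n) \<psi>) (\<lambda>_. w) sequentially"
      proof (rule uniform_limitI)
        fix e :: real assume "e > 0"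
        then have "\<forall>\<^sub>F n in sequentially. \<forall>x\<in>UNIV. dist (h x * (transfer_op ?T ?F ^^ n) \<psi> x) (h x * w) < m * e"
          using uniform_limitD[OF lim, of "m * e"] m by (simp add: eq)
        then show "\<forall>\<^sub>F n in sequentially. \<forall>x\<in>UNIV. dist ((transfer_op ?T ?F ^^ n) \<psi> x) w < e"
        proof (rule eventually_mono, intro ballI)
          fix n x assume "\<forall>x\<in>UNIV. dist (h x * (transfer_op ?T ?F ^^ n) \<psi> x) (h x * w) < m * e"
          then have "h x * dist ((transfer_op ?T ?F ^^ n) \<psi> x) w < m * e"
            by (simp add: dist_real_def abs_mult abs_of_pos[OF hpos] flip: right_diff_distrib)
          moreover have "m * dist ((transfer_op ?T ?F ^^ n) \<psi> x) w \<le> h x * dist ((transfer_op ?T ?F ^^ n) \<psi> x) w"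
            using m by (intro mult_right_mono) auto
          ultimately have "m * dist ((transfer_op ?T ?F ^^ n) \<psi> x) w < m * e" by linarith
          then show "dist ((transfer_op ?T ?F ^^ n) \<psi> x) w < e" using m(1) by simp
        qed
      qed
      then show ?thesis by blast
    qed
  qed (use \<Omega> orderly \<rho>1 \<rho>2 K1 in \<open>auto simp: \<rho>_def c_def K_def\<close>)
  then show ?thesis by (rule that)
qed

text \<open>Multiplication by \<open>h\<close> conjugates \<open>chi * P\<close> to the transfer
  operator, and it preserves the function space in both directions. A \<open>z\<close> outside the
  disc of radius \<open>chi * r\<close> thus reduces to \<open>resolvent\<close> at
  \<open>z / chi\<close>.\<close>

theorem theorem2:
  fixes V \<omega> \<Omega> :: "real \<Rightarrow> real" and f :: "circle \<Rightarrow> real" and chi :: real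
  assumes "admissible V"
    and "modulus_of_continuity \<omega>"
    and "modulus_of_continuity \<Omega>"
    and "compatible (circle_map V) \<Omega> \<omega>"
    and "concave_on {0..} \<Omega>"
    and "vanishes_orderly \<Omega>"
    and "f \<in> modulus_space \<omega>"
    and "maximal_eigenvalue (circle_map V) \<Omega> f chi"
  shows "\<exists>r<chi. \<forall>z \<in> spectrum_on (modulus_space \<Omega>) (modulus_norm \<Omega>)
                        (transfer_op (circle_map V) f).
           z \<noteq> complex_of_real chi \<longrightarrow> cmod z \<le> r"
proof -
  let ?T = "circle_map V" and ?X = "modulus_space \<Omega> :: (circle \<Rightarrow> complex) set"
  obtain h \<nu> where rpf: "RPF_triple ?T \<Omega> f chi h \<nu>"
    using assms(8) by (auto simp: maximal_eigenvalue_def)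
  have chi: "chi > 0" and hpos: "\<And>x. h x > 0" and h: "h \<in> modulus_space \<Omega>"
    using rpf by (auto simp: RPF_triple_def)
  define F where "F = normalised_potential ?T f chi h"
  note mod = assms(3)
  obtain \<rho> lam c K where "normalised_transfer ?T F \<Omega> \<rho> lam c K"
    using RPF_normalised_transfer[OF assms(1-4) assms(6,7) rpf] unfolding F_def by blast
  then interpret normalised_transfer ?T F \<Omega> \<rho> lam c K .
  obtain r where r: "0 < r" "r < 1" and inj:
    "\<And>z (\<phi> :: circle \<Rightarrow> complex) A. r < cmod z \<Longrightarrow> z \<noteq> 1 \<Longrightarrow> modulus_bound \<Omega> \<phi> A \<Longrightarrow>
       (\<And>x. z * \<phi> x = P \<phi> x) \<Longrightarrow> \<phi> = (\<lambda>_. 0)"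
    and solve: "\<And>z. r < cmod z \<Longrightarrow> z \<noteq> 1 \<Longrightarrow> \<exists>R. \<forall>(\<psi> :: circle \<Rightarrow> complex) A. modulus_bound \<Omega> \<psi> A \<longrightarrow>
       (\<exists>\<phi>. modulus_bound \<Omega> \<phi> (R * A) \<and> (\<forall>x. z * \<phi> x - P \<phi> x = \<psi> x))"
    by (rule resolvent) blast
  define H where "H = modulus_norm \<Omega> h"
  have H: "modulus_bound \<Omega> h H" unfolding H_def by (rule modulus_space_bound[OF h mod])
  have Hc: "modulus_bound \<Omega> (\<lambda>x. complex_of_real (h x)) H"
    using H by (simp add: modulus_bound_def flip: of_real_diff)
  obtain I where I: "modulus_bound \<Omega> (\<lambda>x. complex_of_real (inverse (h x))) I"
  proof -
    obtain x0 where x0: "\<And>x. h x0 \<le> h x"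
      using continuous_attains_inf[OF compact_circle, of h] h by (auto simp: modulus_space_def)
    define m where "m = h x0"
    have m: "m > 0" "\<And>x. m \<le> h x" using hpos x0 by (auto simp: m_def)
    have H0: "H \<ge> 0" using H by (rule modulus_bound_nonneg)
    \<comment> \<open>One constant must serve both parts, so the sup bound \<open>1 / m\<close> and
      the seminorm bound \<open>H / (m * m)\<close> are added.\<close>
    have "modulus_bound \<Omega> (\<lambda>x. complex_of_real (inverse (h x))) (1 / m + H / (m * m))"
      unfolding modulus_bound_def
    proof (intro conjI allI)
      fix x y :: circle
      have "inverse (h x) \<le> 1 / m" using m hpos[of x] by (simp add: inverse_eq_divide frac_le)
      then show "cmod (complex_of_real (inverse (h x))) \<le> 1 / m + H / (m * m)"
        using hpos[of x] divide_nonneg_pos[OF H0, of "m * m"] m(1) by (simp add: norm_inverse)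
      have "inverse (h x) - inverse (h y) = (h y - h x) / (h x * h y)"
        using hpos[of x] hpos[of y] by (simp add: field_simps)
      then have "\<bar>inverse (h x) - inverse (h y)\<bar> = \<bar>h x - h y\<bar> / (h x * h y)"
        using hpos[of x] hpos[of y] by (simp add: abs_mult abs_minus_commute)
      then have "cmod (complex_of_real (inverse (h x)) - complex_of_real (inverse (h y))) = \<bar>h x - h y\<bar> / (h x * h y)"
        by (simp only: norm_of_real flip: of_real_diff)
      also have "\<dots> \<le> (H * \<Omega> (dist x y)) / (m * m)"
      proof (intro frac_le mult_mono)
        show hxy: "\<bar>h x - h y\<bar> \<le> H * \<Omega> (dist x y)" using H by (simp add: modulus_bound_def)
        show "0 \<le> H * \<Omega> (dist x y)" using abs_ge_zero hxy by (rule order_trans)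
      qed (use m in \<open>auto simp: less_imp_le[OF hpos]\<close>)
      also have "\<dots> \<le> (1 / m + H / (m * m)) * \<Omega> (dist x y)"
        using m modulus_nonneg[OF mod, of "dist x y"] by (simp add: distrib_right)
      finally show "cmod (complex_of_real (inverse (h x)) - complex_of_real (inverse (h y)))
          \<le> (1 / m + H / (m * m)) * \<Omega> (dist x y)" .
    qed
    then show ?thesis by (rule that)
  qed
  define up :: "(circle \<Rightarrow> complex) \<Rightarrow> circle \<Rightarrow> complex" where "up \<phi> = (\<lambda>x. of_real (h x) * \<phi> x)" for \<phi>
  define dn :: "(circle \<Rightarrow> complex) \<Rightarrow> circle \<Rightarrow> complex" where "dn \<phi> = (\<lambda>x. of_real (inverse (h x)) * \<phi> x)" for \<phi>
  have hn: "h x \<noteq> 0" for x using hpos[of x] by simp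
  have updn: "up (dn \<phi>) = \<phi>" "dn (up \<phi>) = \<phi>" for \<phi> by (auto simp: up_def dn_def hn)
  have up: "modulus_bound \<Omega> (up \<phi>) (2 * H * A)" if "modulus_bound \<Omega> \<phi> A" for \<phi> A
    unfolding up_def by (rule modulus_bound_mult[OF Hc that mod])
  have dn: "modulus_bound \<Omega> (dn \<phi>) (2 * I * A)" if "modulus_bound \<Omega> \<phi> A" for \<phi> A
    unfolding dn_def by (rule modulus_bound_mult[OF I that mod])
  have Lup: "transfer_op ?T f (up \<phi>) x = of_real chi * of_real (h x) * P \<phi> x" for \<phi> x
    using transfer_op_normalised[OF chi hpos, where T = ?T and f = f and \<phi> = \<phi> and x = x]
    by (simp add: up_def F_def scaleR_conv_of_real)
  show ?thesis
  proof (intro exI[of _ "chi * r"] conjI ballI impI)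
    show "chi * r < chi" using chi r by simp
    fix z assume spec: "z \<in> spectrum_on ?X (modulus_norm \<Omega>) (transfer_op ?T f)"
      and z: "z \<noteq> complex_of_real chi"
    show "cmod z \<le> chi * r"
    proof (rule ccontr)
      assume "\<not> cmod z \<le> chi * r"
      define q where "q = z / of_real chi"
      have q: "r < cmod q" "q \<noteq> 1" "z = of_real chi * q"
        using \<open>\<not> cmod z \<le> chi * r\<close> z chi by (auto simp: q_def norm_divide field_simps)
      define G where "G \<phi> = (\<lambda>x. z * \<phi> x - transfer_op ?T f \<phi> x)" for \<phi> :: "circle \<Rightarrow> complex"
      \<comment> \<open>The conjugation of \<open>z - L\<close> to \<open>chi * (q - P)\<close>; it
        transfers both injectivity and solvability.\<close>
      have Gup: "G (up \<phi>) = (\<lambda>x. of_real chi * up (\<lambda>x. q * \<phi> x - P \<phi> x) x)" for \<phi>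
        unfolding G_def Lup q(3) by (simp add: up_def algebra_simps)
      obtain R where R: "\<And>(\<psi> :: circle \<Rightarrow> complex) A. modulus_bound \<Omega> \<psi> A \<Longrightarrow>
         \<exists>\<phi>. modulus_bound \<Omega> \<phi> (R * A) \<and> (\<forall>x. q * \<phi> x - P \<phi> x = \<psi> x)"
        using solve[OF q(1,2)] by blast
      obtain B where B: "\<And>(\<phi> :: circle \<Rightarrow> complex) A. modulus_bound \<Omega> \<phi> A \<Longrightarrow> modulus_bound \<Omega> (P \<phi>) (B * A)"
        by (rule P_modulus_bound) blast
      have bound: "modulus_bound \<Omega> \<phi> (modulus_norm \<Omega> \<phi>)" if "\<phi> \<in> ?X" for \<phi>
        by (rule modulus_space_bound[OF that mod])
      have space: "\<phi> \<in> ?X" if "modulus_bound \<Omega> \<phi> A" for \<phi> A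
        by (rule modulus_bound_in_space[OF that mod])
      have G_in: "G \<phi> \<in> ?X" if mem: "\<phi> \<in> ?X" for \<phi>
      proof -
        obtain A where A: "modulus_bound \<Omega> (dn \<phi>) A" using dn[OF bound[OF mem]] by blast
        have "modulus_bound \<Omega> (\<lambda>x. q * dn \<phi> x + (- 1) * P (dn \<phi>) x) (norm q * A + norm (- 1 :: complex) * (B * A))"
          by (intro modulus_bound_add modulus_bound_cmult A B)
        then obtain A' where "modulus_bound \<Omega> (\<lambda>x. q * dn \<phi> x - P (dn \<phi>) x) A'" by auto
        from space[OF modulus_bound_cmult[OF up[OF this]]] show ?thesis
          using Gup[of "dn \<phi>"] by (simp add: updn)
      qed
      have G_inj: "inj_on G ?X"
      proof (rule inj_onI)
        fix \<phi> \<psi> assume \<phi>: "\<phi> \<in> ?X" and \<psi>: "\<psi> \<in> ?X" and eq: "G \<phi> = G \<psi>"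
        have "modulus_bound \<Omega> (\<lambda>x. dn \<phi> x + (- 1) * dn \<psi> x)
            (2 * I * modulus_norm \<Omega> \<phi> + norm (- 1 :: complex) * (2 * I * modulus_norm \<Omega> \<psi>))"
          by (intro modulus_bound_add modulus_bound_cmult dn bound \<phi> \<psi>)
        then obtain A where A: "modulus_bound \<Omega> (\<lambda>x. dn \<phi> x - dn \<psi> x) A" by auto
        have "G (up (dn \<phi>)) = G (up (dn \<psi>))" using eq by (simp add: updn)
        then have "q * dn \<phi> x - P (dn \<phi>) x = q * dn \<psi> x - P (dn \<psi>) x" for x
          unfolding Gup using chi hn by (simp add: up_def fun_eq_iff)
        then have "q * (dn \<phi> x - dn \<psi> x) = P (\<lambda>x. dn \<phi> x - dn \<psi> x) x" for x
          by (simp add: transfer_op_diff algebra_simps)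
        then have "(\<lambda>x. dn \<phi> x - dn \<psi> x) = (\<lambda>_. 0)" by (rule inj[OF q(1,2) A])
        then have "dn \<phi> = dn \<psi>" by (simp add: fun_eq_iff)
        then show "\<phi> = \<psi>" by (metis updn(1))
      qed
      define K' where "K' = 2 * H * (R * (norm (1 / complex_of_real chi) * (2 * I)))"
      have G_solve: "\<exists>\<phi>. modulus_bound \<Omega> \<phi> (K' * modulus_norm \<Omega> \<psi>) \<and> G \<phi> = \<psi>" if mem: "\<psi> \<in> ?X" for \<psi>
      proof -
        obtain \<phi> where \<phi>: "modulus_bound \<Omega> \<phi> (R * (norm (1 / complex_of_real chi) * (2 * I * modulus_norm \<Omega> \<psi>)))"
          and eq: "\<And>x. q * \<phi> x - P \<phi> x = 1 / of_real chi * dn \<psi> x"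
          using R[OF modulus_bound_cmult[OF dn[OF bound[OF mem]]]] by blast
        have "G (up \<phi>) = (\<lambda>x. of_real chi * (of_real (h x) * (1 / of_real chi * dn \<psi> x)))"
          unfolding Gup eq by (simp add: up_def)
        also have "\<dots> = \<psi>" using chi hn by (simp add: dn_def fun_eq_iff)
        finally show ?thesis using up[OF \<phi>] by (intro exI[of _ "up \<phi>"]) (simp add: K'_def ac_simps)
      qed
      have "bij_betw G ?X ?X"
        unfolding bij_betw_def
      proof (intro conjI G_inj subset_antisym subsetI)
        show "\<psi> \<in> ?X" if "\<psi> \<in> G ` ?X" for \<psi> using that G_in by blast
        show "\<psi> \<in> G ` ?X" if "\<psi> \<in> ?X" for \<psi> using G_solve[OF that] space by blast
      qed
      \<comment> \<open>The solution supplied by \<open>G_solve\<close> has a controlled bound, and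
        injectivity identifies it with \<open>\<phi>\<close>. The \<open>2\<close> converts
        \<open>modulus_bound\<close> into the norm.\<close>
      moreover have "modulus_norm \<Omega> \<phi> \<le> 2 * K' * modulus_norm \<Omega> (G \<phi>)" if mem: "\<phi> \<in> ?X" for \<phi>
      proof -
        obtain \<phi>' where \<phi>': "modulus_bound \<Omega> \<phi>' (K' * modulus_norm \<Omega> (G \<phi>))" "G \<phi>' = G \<phi>"
          using G_solve[OF G_in[OF mem]] by blast
        then have "\<phi>' = \<phi>" using G_inj space mem by (auto dest: inj_onD)
        then show ?thesis using modulus_bound_norm_le[OF \<phi>'(1) mod] by simp
      qed
      ultimately have "z \<notin> spectrum_on ?X (modulus_norm \<Omega>) (transfer_op ?T f)"
        unfolding spectrum_on_def G_def by blast
      then show False using spec by simp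
    qed
  qed
qed

end
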